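(* Let $\alpha,\beta$ be Martin-Löf random left-c.e. reals and let $\mathcal{D}(\alpha,\beta)=\inf\{q\in\mathbb{Q}^+ : q\alpha-\beta \text{ is a left-c.e. real}\}$. Then: (a) if $\mathcal{D}(\alpha,\beta)<1$ then $\alpha-\beta$ is a Martin-Löf random left-c.e. real; (b) if $\mathcal{D}(\alpha,\beta)=1$ then $\alpha-\beta$ is not Martin-Löf random; (c) if $\mathcal{D}(\alpha,\beta)>1$ then $\alpha-\beta$ is a Martin-Löf random right-c.e. real.
   Context: A real is left-c.e. if it is the limit of a computable increasing sequence of rationals, and right-c.e. if it is the limit of a computable decreasing sequence of rationals. $\mathbb{Q}^+$ denotes the positive rationals. A real is Martin-Löf random if (the binary expansion of its fractional part) is Martin-Löf random. *)

theory Defs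
  imports Complex_Main "HOL-Library.Nat_Bijection"
begin

datatype recf = Zero | Succ | Proj nat | Comp recf "recf list" | Prim recf recf | Mn recf

inductive eval :: "recf \<Rightarrow> nat list \<Rightarrow> nat \<Rightarrow> bool" where
  eval_Zero: "eval Zero xs 0"
| eval_Succ: "eval Succ (x # xs) (Suc x)"
| eval_Proj: "i < length xs \<Longrightarrow> eval (Proj i) xs (xs ! i)"
| eval_Comp: "list_all2 (\<lambda>g y. eval g xs y) gs ys \<Longrightarrow> eval f ys z \<Longrightarrow> eval (Comp f gs) xs z"
| eval_Prim0: "eval f xs y \<Longrightarrow> eval (Prim f g) (0 # xs) y"
| eval_PrimS: "eval (Prim f g) (n # xs) y \<Longrightarrow> eval g (y # n # xs) z \<Longrightarrow> eval (Prim f g) (Suc n # xs) z"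
| eval_Mn: "eval f (y # xs) 0 \<Longrightarrow> (\<forall>y'<y. \<exists>v. eval f (y' # xs) v \<and> v > 0) \<Longrightarrow> eval (Mn f) xs y"

definition computable :: "(nat \<Rightarrow> nat) \<Rightarrow> bool" where
  "computable f \<longleftrightarrow> (\<exists>c. \<forall>n. eval c [n] (f n))"

definition ce_set :: "nat set \<Rightarrow> bool" where
  "ce_set A \<longleftrightarrow> (\<exists>c. \<forall>x. x \<in> A \<longleftrightarrow> (\<exists>y. eval c [x] y))"

definition computable_rat_seq :: "(nat \<Rightarrow> rat) \<Rightarrow> bool" where
  "computable_rat_seq q \<longleftrightarrow> (\<exists>a b d. computable a \<and> computable b \<and> computable d \<and>
      (\<forall>n. q n = (of_nat (a n) - of_nat (b n)) / of_nat (Suc (d n))))"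

definition left_ce :: "real \<Rightarrow> bool" where
  "left_ce x \<longleftrightarrow> (\<exists>q. computable_rat_seq q \<and> incseq q \<and> (\<lambda>n. real_of_rat (q n)) \<longlonglongrightarrow> x)"

definition right_ce :: "real \<Rightarrow> bool" where
  "right_ce x \<longleftrightarrow> (\<exists>q. computable_rat_seq q \<and> decseq q \<and> (\<lambda>n. real_of_rat (q n)) \<longlonglongrightarrow> x)"

text \<open>Injective coding of binary strings as naturals (binary digits with a leading sentinel 1).\<close>
definition str_code :: "bool list \<Rightarrow> nat" where
  "str_code w = foldr (\<lambda>b n. 2 * n + (if b then 1 else 0)) w 1"

text \<open>Lebesgue measure of the open set generated by a set of strings U is at most r:
  for each length L, the fraction of strings of length L extending some member of U is at most r.\<close>
definition measure_le :: "bool list set \<Rightarrow> real \<Rightarrow> bool" where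
  "measure_le U r \<longleftrightarrow> (\<forall>L. real (card {w. length w = L \<and> (\<exists>u\<in>U. take (length u) w = u)}) \<le> r * 2 ^ L)"

definition mloef_test :: "(nat \<Rightarrow> bool list set) \<Rightarrow> bool" where
  "mloef_test U \<longleftrightarrow> ce_set {prod_encode (n, str_code w) | n w. w \<in> U n}
      \<and> (\<forall>n. measure_le (U n) ((1/2) ^ n))"

definition mloef_random_seq :: "(nat \<Rightarrow> bool) \<Rightarrow> bool" where
  "mloef_random_seq X \<longleftrightarrow> (\<forall>U. mloef_test U \<longrightarrow> (\<exists>n. \<forall>k. map X [0..<k] \<notin> U n))"

text \<open>The i-th binary digit (i = 0 is the first digit after the point) of the fractional part.\<close>
definition frac_bit :: "real \<Rightarrow> nat \<Rightarrow> bool" where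
  "frac_bit x i = odd \<lfloor>frac x * 2 ^ (Suc i)\<rfloor>"

definition mloef_random_real :: "real \<Rightarrow> bool" where
  "mloef_random_real x \<longleftrightarrow> mloef_random_seq (frac_bit x)"

definition Dist :: "real \<Rightarrow> real \<Rightarrow> real" where
  "Dist \<alpha> \<beta> = Inf {real_of_rat q | q. q > 0 \<and> left_ce (real_of_rat q * \<alpha> - \<beta>)}"

end

(* Martin-Loef randomness is used in its Solovay form: a random real lies in only finitely many
   intervals of a computable sequence of rational intervals with finite total length.

   Let alpha be random and left-c.e. with approximations A, and beta left-c.e. with approximations B.
   For rationals 0 < c < d either d alpha - beta or beta - c alpha is left-c.e.: otherwise the
   approximations of both exceed their limits infinitely often, so the slope
   (beta - B s) / (alpha - A s) oscillates below c and above d, and as for the upcrossings of a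
   martingale each oscillation shrinks a cover of alpha by the factor c / d. The same covering
   argument gives the Kucera-Slaman theorem: some q alpha - beta is left-c.e.

   Hence D < 1 and D > 1 display alpha - beta, respectively beta - alpha, as the sum of a left-c.e.
   real and a positive multiple of alpha, and such a sum is random. If alpha - beta is random, then
   its approximations finally stay on one side of it, so that it or its negative is left-c.e.;
   the Kucera-Slaman theorem for this real then makes D different from 1. *)
theory Submission
  imports Defs
begin

section \<open>Computable functions\<close>

text \<open>No stage of a computation reveals that an approximation exceeds its limit, so the
  oscillation can only be guessed. A marker stands at the largest value seen so far and is withdrawn
  when a larger one appears, but the intervals enumerated on behalf of a withdrawn marker stay in
  the test. The total length is finite nevertheless, since over all stages at which the marker of a
  level is kept, right or wrong, the function of that level has no net gain. For two alternating
  functions this turns growth of one approximation into a bound on the other and back, and each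
  round trip costs the factor c / d. In case (b) the obstacle is that an infimum equal to 1 says
  nothing about slope 1 itself. The Kucera-Slaman theorem is therefore applied with the difference
  as the dominating real, and solving for \<beta> gives a slope strictly below 1, or strictly above
  1 with the opposite sign. Randomness is defined by c.e. sets of strings whereas Solovay tests are
  computable sequences. Passing from one to the other requires decidable stages of an enumeration,
  which is the purpose of the evaluator with fuel.\<close>

definition cfun :: "nat \<Rightarrow> (nat list \<Rightarrow> nat) \<Rightarrow> bool" where
  "cfun n f \<longleftrightarrow> (\<exists>c. \<forall>xs. length xs = n \<longrightarrow> eval c xs (f xs))"

lemma cfun_cong:
  "(\<And>xs. length xs = n \<Longrightarrow> f xs = g xs) \<Longrightarrow> cfun n f = cfun n g"
  by (simp add: cfun_def)

lemma computable_cong: "computable f \<Longrightarrow> (\<And>n. g n = f n) \<Longrightarrow> computable g"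
  by (simp add: computable_def)

lemma cfun_comp:
  assumes f: "cfun (length gs) f" and gs: "\<And>g. g \<in> set gs \<Longrightarrow> cfun n g"
  shows "cfun n (\<lambda>xs. f (map (\<lambda>g. g xs) gs))"
proof -
  have "\<exists>cs. list_all2 (\<lambda>c g. \<forall>xs. length xs = n \<longrightarrow> eval c xs (g xs)) cs gs"
    using gs
  proof (induction gs)
    case (Cons g gs)
    then obtain cs c where
      "list_all2 (\<lambda>c g. \<forall>xs. length xs = n \<longrightarrow> eval c xs (g xs)) cs gs"
      "\<forall>xs. length xs = n \<longrightarrow> eval c xs (g xs)"
      unfolding cfun_def by (meson list.set_intros)
    then show ?case by (intro exI[of _ "c # cs"]) simp
  qed simp
  then obtain cs where cs: "list_all2 (\<lambda>c g. \<forall>xs. length xs = n \<longrightarrow> eval c xs (g xs)) cs gs" ..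
  obtain c where c: "\<And>ys. length ys = length gs \<Longrightarrow> eval c ys (f ys)"
    using f unfolding cfun_def by blast
  have "eval (Comp c cs) xs (f (map (\<lambda>g. g xs) gs))" if "length xs = n" for xs
  proof (rule eval_Comp)
    show "list_all2 (\<lambda>c y. eval c xs y) cs (map (\<lambda>g. g xs) gs)"
      using cs that by (auto simp: list_all2_conv_all_nth)
  qed (simp add: c)
  then show ?thesis unfolding cfun_def by blast
qed

lemma cfun_nth: "i < n \<Longrightarrow> cfun n (\<lambda>xs. xs ! i)"
  unfolding cfun_def by (metis eval_Proj)

lemma cfun_zero: "cfun n (\<lambda>_. 0)"
  unfolding cfun_def by (metis eval_Zero)

lemma computable_cfun: "computable f \<longleftrightarrow> cfun 1 (\<lambda>xs. f (xs ! 0))"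
  unfolding computable_def cfun_def
  by (metis One_nat_def length_0_conv length_Suc_conv list.size(3,4) nth_Cons_0 add.right_neutral add_Suc_right)

lemma cfun_comp1: "computable f \<Longrightarrow> cfun n g \<Longrightarrow> cfun n (\<lambda>xs. f (g xs))"
  using cfun_comp[of "[g]" "\<lambda>xs. f (xs ! 0)" n] by (simp add: computable_cfun)

lemma cfun_comp2:
  "cfun 2 (\<lambda>xs. f (xs ! 0) (xs ! 1)) \<Longrightarrow> cfun n g \<Longrightarrow> cfun n h \<Longrightarrow> cfun n (\<lambda>xs. f (g xs) (h xs))"
  using cfun_comp[of "[g, h]" "\<lambda>xs. f (xs ! 0) (xs ! 1)" n] by (auto simp: numeral_2_eq_2)

lemma computable_Suc: "computable Suc"
  unfolding computable_def by (metis eval_Succ)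

lemma computable_id: "computable (\<lambda>n. n)"
  unfolding computable_cfun by (simp add: cfun_nth)

lemma cfun_Suc: "cfun n f \<Longrightarrow> cfun n (\<lambda>xs. Suc (f xs))"
  by (rule cfun_comp1[OF computable_Suc])

lemma cfun_const: "cfun n (\<lambda>_. k)"
  by (induction k) (auto intro: cfun_zero cfun_Suc)

text \<open>\<open>Prim\<close> recurses on its first argument and passes the others on unchanged,
  while here the depth is itself computed from the parameters. Composition with \<open>h\<close>
  followed by all projections supplies both.\<close>

lemma cfun_rec:
  assumes f: "cfun n f" and g: "cfun (Suc (Suc n)) g" and h: "cfun n h"
  shows "cfun n (\<lambda>xs. rec_nat (f xs) (\<lambda>i r. g (r # i # xs)) (h xs))"
proof -
  obtain cf cg where cf: "\<And>xs. length xs = n \<Longrightarrow> eval cf xs (f xs)"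
    and cg: "\<And>xs. length xs = Suc (Suc n) \<Longrightarrow> eval cg xs (g xs)"
    using f g unfolding cfun_def by blast
  have "eval (Prim cf cg) (k # xs) (rec_nat (f xs) (\<lambda>i r. g (r # i # xs)) k)"
    if "length xs = n" for k xs
    by (induction k) (auto intro!: eval_Prim0 eval_PrimS cf cg simp: that)
  then have "cfun (Suc n) (\<lambda>xs. rec_nat (f (tl xs)) (\<lambda>i r. g (r # i # tl xs)) (hd xs))"
    unfolding cfun_def by (intro exI[of _ "Prim cf cg"]) (auto simp: length_Suc_conv)
  then have "cfun n (\<lambda>xs. rec_nat (f (map (\<lambda>i. xs ! i) [0..<n]))
      (\<lambda>i r. g (r # i # map (\<lambda>i. xs ! i) [0..<n])) (h xs))"
    using cfun_comp[of "h # map (\<lambda>i xs. xs ! i) [0..<n]"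
        "\<lambda>xs. rec_nat (f (tl xs)) (\<lambda>i r. g (r # i # tl xs)) (hd xs)" n] h
    by (simp add: o_def) (metis (mono_tags, lifting) atLeastLessThan_iff cfun_nth imageE)
  moreover have "map (\<lambda>i. xs ! i) [0..<n] = xs" if "length xs = n" for xs :: "nat list"
    using that map_nth by blast
  ultimately show ?thesis
    by (simp add: cfun_def)
qed

lemma cfun_add: "cfun n f \<Longrightarrow> cfun n g \<Longrightarrow> cfun n (\<lambda>xs. f xs + g xs)"
proof -
  assume "cfun n f" "cfun n g"
  moreover have "rec_nat a (\<lambda>i r. Suc r) b = a + b" for a b :: nat by (induction b) auto
  ultimately show ?thesis
    using cfun_rec[of n f "\<lambda>zs. Suc (zs ! 0)" g] by (simp add: cfun_Suc cfun_nth)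
qed

lemma cfun_mult: "cfun n f \<Longrightarrow> cfun n g \<Longrightarrow> cfun n (\<lambda>xs. f xs * g xs)"
proof -
  assume a: "cfun n f" "cfun n g"
  have "rec_nat 0 (\<lambda>i r. r + a) b = a * b" for a b :: nat by (induction b) auto
  moreover have "cfun (Suc (Suc 2)) (\<lambda>zs. zs ! 0 + zs ! 2)"
    by (intro cfun_add cfun_nth) auto
  ultimately have "cfun 2 (\<lambda>xs. xs ! 0 * xs ! 1)"
    using cfun_rec[of 2 "\<lambda>_. 0" "\<lambda>zs. zs ! 0 + zs ! 2" "\<lambda>xs. xs ! 1"]
    by (simp add: cfun_zero cfun_nth)
  from cfun_comp2[OF this a] show ?thesis .
qed

lemma cfun_pred: "cfun n f \<Longrightarrow> cfun n (\<lambda>xs. f xs - 1)"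
proof -
  assume a: "cfun n f"
  have "rec_nat 0 (\<lambda>i r. i) b = b - 1" for b :: nat by (cases b) auto
  then show ?thesis
    using cfun_rec[OF cfun_zero _ a, of "\<lambda>zs. zs ! 1"] by (simp add: cfun_nth)
qed

lemma cfun_diff: "cfun n f \<Longrightarrow> cfun n g \<Longrightarrow> cfun n (\<lambda>xs. f xs - g xs)"
proof -
  assume "cfun n f" "cfun n g"
  moreover have "rec_nat a (\<lambda>i r. r - 1) b = a - b" for a b :: nat by (induction b) auto
  ultimately show ?thesis
    using cfun_rec[of n f "\<lambda>zs. zs ! 0 - 1" g] by (simp add: cfun_pred[simplified] cfun_nth)
qed

section \<open>The pairing function and its projections\<close>

lemma computable_triangle: "computable triangle"
proof -
  have "rec_nat 0 (\<lambda>i r. r + Suc i) b = triangle b" for b by (induction b) auto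
  moreover have "cfun (Suc (Suc 1)) (\<lambda>zs. zs ! 0 + Suc (zs ! 1))"
    by (intro cfun_add cfun_Suc cfun_nth) auto
  ultimately show ?thesis unfolding computable_cfun
    using cfun_rec[OF cfun_zero _ cfun_nth, of 1 "\<lambda>zs. zs ! 0 + Suc (zs ! 1)" 0]
    by simp
qed

lemma cfun_prod_encode: "cfun n f \<Longrightarrow> cfun n g \<Longrightarrow> cfun n (\<lambda>xs. prod_encode (f xs, g xs))"
  unfolding prod_encode_def by (simp add: cfun_add cfun_comp1[OF computable_triangle])

abbreviation p1 :: "nat \<Rightarrow> nat" where "p1 p \<equiv> fst (prod_decode p)"
abbreviation p2 :: "nat \<Rightarrow> nat" where "p2 p \<equiv> snd (prod_decode p)"

text \<open>The sum of the components is the number of the diagonal that contains \<open>p\<close>,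
  so it counts the positive triangular numbers up to \<open>p\<close>. With truncated subtraction,
  \<open>1 - (x - p)\<close> is the indicator of \<open>x \<le> p\<close>.\<close>

lemma p1_add_p2_conv:
  "p1 p + p2 p = rec_nat 0 (\<lambda>i r. r + (1 - (triangle (Suc i) - p))) p"
proof -
  define s where "s = p1 p + p2 p"
  have p: "triangle s + p1 p = p"
    using prod_decode_inverse[of p] unfolding prod_encode_def s_def by (simp add: case_prod_beta)
  have "s \<le> triangle s" by (induction s) auto
  then have "s \<le> p" using p by simp
  have mono: "triangle i \<le> triangle j" if "i \<le> j" for i j
    using lift_Suc_mono_le[of triangle i j] that by simp
  have eq: "triangle (Suc i) \<le> p \<longleftrightarrow> i < s" for i
  proof
    assume "i < s"
    then have "triangle (Suc i) \<le> triangle s" by (intro mono) simp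
    then show "triangle (Suc i) \<le> p" using p by simp
  next
    assume a: "triangle (Suc i) \<le> p"
    show "i < s"
    proof (rule ccontr)
      assume "\<not> i < s"
      then have "triangle (Suc s) \<le> triangle (Suc i)" by (intro mono) simp
      moreover have "p1 p \<le> s" by (simp add: s_def)
      ultimately show False using a p by simp
    qed
  qed
  have "rec_nat 0 (\<lambda>i r. r + (1 - (triangle (Suc i) - p))) k = min k s" for k
  proof (induction k)
    case (Suc k)
    show ?case using eq[of k] Suc by (cases "k < s") auto
  qed simp
  then show ?thesis using \<open>s \<le> p\<close> by (simp add: s_def)
qed

lemma computable_p1: "computable p1" and computable_p2: "computable p2"
proof -
  have "cfun (Suc (Suc 1)) (\<lambda>zs. zs ! 0 + (1 - (triangle (Suc (zs ! 1)) - zs ! 2)))"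
    by (intro cfun_add cfun_diff cfun_const cfun_comp1[OF computable_triangle] cfun_Suc cfun_nth) auto
  from cfun_rec[OF cfun_zero this cfun_nth, of 0]
  have s: "cfun 1 (\<lambda>xs. p1 (xs ! 0) + p2 (xs ! 0))"
    unfolding p1_add_p2_conv by (simp add: numeral_2_eq_2)
  have e: "p1 p = p - triangle (p1 p + p2 p)" for p
    using prod_decode_inverse[of p] unfolding prod_encode_def by (simp add: case_prod_beta)
  have "cfun 1 (\<lambda>xs. xs ! 0 - triangle (p1 (xs ! 0) + p2 (xs ! 0)))"
    by (intro cfun_diff cfun_nth cfun_comp1[OF computable_triangle] s) simp
  then show 1: "computable p1" unfolding computable_cfun by (simp only: e[symmetric])
  have "cfun 1 (\<lambda>xs. (p1 (xs ! 0) + p2 (xs ! 0)) - p1 (xs ! 0))"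
    using cfun_diff[OF s 1[unfolded computable_cfun]] .
  then show "computable p2" unfolding computable_cfun by simp
qed

text \<open>Computable functions of several arguments are treated as functions of one argument that codes
  a pair, so that a single set of introduction rules covers all arities.\<close>

named_theorems comp_intros

lemma computable_comp: "computable f \<Longrightarrow> computable g \<Longrightarrow> computable (\<lambda>n. f (g n))"
  unfolding computable_cfun[of g] computable_cfun[of "\<lambda>n. f (g n)"] by (rule cfun_comp1)

lemma computable_const [comp_intros]: "computable (\<lambda>_. k)"
  unfolding computable_cfun by (rule cfun_const)

declare computable_id [comp_intros]

lemma computable_p1_comp [comp_intros]: "computable f \<Longrightarrow> computable (\<lambda>n. p1 (f n))"
  by (rule computable_comp[OF computable_p1])

lemma computable_p2_comp [comp_intros]: "computable f \<Longrightarrow> computable (\<lambda>n. p2 (f n))"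
  by (rule computable_comp[OF computable_p2])

lemma computable_Suc_comp [comp_intros]: "computable f \<Longrightarrow> computable (\<lambda>n. Suc (f n))"
  by (rule computable_comp[OF computable_Suc])

lemma computable_pair [comp_intros]:
  "computable f \<Longrightarrow> computable g \<Longrightarrow> computable (\<lambda>n. prod_encode (f n, g n))"
  unfolding computable_cfun by (rule cfun_prod_encode)

lemma computable_add [comp_intros]:
  "computable f \<Longrightarrow> computable g \<Longrightarrow> computable (\<lambda>n. f n + g n)"
  unfolding computable_cfun by (rule cfun_add)

lemma computable_mult [comp_intros]:
  "computable f \<Longrightarrow> computable g \<Longrightarrow> computable (\<lambda>n. f n * g n)"
  unfolding computable_cfun by (rule cfun_mult)

lemma computable_diff [comp_intros]:
  "computable f \<Longrightarrow> computable g \<Longrightarrow> computable (\<lambda>n. f n - g n)"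
  for f g :: "nat \<Rightarrow> nat"
  unfolding computable_cfun by (rule cfun_diff)

lemma computable2:
  assumes "computable (\<lambda>p. f (p1 p) (p2 p))" "computable g" "computable h"
  shows "computable (\<lambda>n. f (g n) (h n))"
  using computable_comp[OF assms(1) computable_pair[OF assms(2,3)]] by simp

lemma computable_rec:
  assumes "computable f" "computable k"
    and g: "computable (\<lambda>p. g (p1 p) (p1 (p2 p)) (p2 (p2 p)))"
  shows "computable (\<lambda>n. rec_nat (f n) (\<lambda>i r. g n i r) (k n))"
proof -
  have "cfun (Suc (Suc 1)) (\<lambda>zs. prod_encode (zs ! 2, prod_encode (zs ! 1, zs ! 0)))"
    by (intro cfun_prod_encode cfun_nth) auto
  from cfun_rec[OF assms(1)[unfolded computable_cfun] cfun_comp1[OF g this]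
      assms(2)[unfolded computable_cfun]]
  show ?thesis unfolding computable_cfun by (simp add: numeral_2_eq_2)
qed

lemma computable_sum [comp_intros]:
  assumes "computable k" "computable (\<lambda>p. f (p1 p) (p2 p))"
  shows "computable (\<lambda>n. \<Sum>i<k n. f n i)"
proof -
  have "rec_nat 0 (\<lambda>i r. r + f n i) k = (\<Sum>i<k. f n i)" for n k by (induction k) auto
  moreover have "computable (\<lambda>n. rec_nat 0 (\<lambda>i r. r + f n i) (k n))"
    by (intro computable_rec computable2[OF assms(2)] comp_intros assms)
  ultimately show ?thesis by simp
qed

lemma computable_power [comp_intros]:
  assumes "computable f" "computable k"
  shows "computable (\<lambda>n. f n ^ k n)"
proof -
  have "rec_nat 1 (\<lambda>i r. r * f n) k = f n ^ k" for n k by (induction k) auto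
  moreover have "computable (\<lambda>n. rec_nat 1 (\<lambda>i r. r * f n) (k n))"
    by (intro computable_rec computable_comp[OF assms(1)] comp_intros assms)
  ultimately show ?thesis by simp
qed

section \<open>Decidable predicates and bounded quantification\<close>

definition decidable :: "(nat \<Rightarrow> bool) \<Rightarrow> bool" where
  "decidable P \<longleftrightarrow> computable (\<lambda>n. if P n then 1 else 0)"

lemma decidable_const: "decidable (\<lambda>_. P)"
  by (simp add: decidable_def computable_const)

lemma decidable_comp: "decidable P \<Longrightarrow> computable g \<Longrightarrow> decidable (\<lambda>n. P (g n))"
  unfolding decidable_def by (rule computable_comp)

lemma decidable2:
  assumes "decidable (\<lambda>p. P (p1 p) (p2 p))" "computable g" "computable h"
  shows "decidable (\<lambda>n. P (g n) (h n))"
  using decidable_comp[OF assms(1) computable_pair[OF assms(2,3)]] by simp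

lemma computable_if [comp_intros]:
  assumes "decidable P" "computable f" "computable g"
  shows "computable (\<lambda>n. if P n then f n else g n)"
proof -
  have "computable (\<lambda>n. (if P n then 1 else 0) * f n + (1 - (if P n then 1 else 0)) * g n)"
    using assms by (intro comp_intros) (auto simp: decidable_def)
  then show ?thesis by (rule computable_cong) simp
qed

lemma decidable_nat_le [comp_intros]:
  assumes "computable f" "computable g"
  shows "decidable (\<lambda>n. f n \<le> g n)"
proof -
  have "computable (\<lambda>n. 1 - (f n - g n))" using assms by (intro comp_intros)
  then show ?thesis unfolding decidable_def by (rule computable_cong) simp
qed

lemma decidable_nat_less [comp_intros]:
  "computable f \<Longrightarrow> computable g \<Longrightarrow> decidable (\<lambda>n. f n < g n)"
  unfolding less_eq_Suc_le by (intro comp_intros)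

lemma decidable_not [comp_intros]:
  assumes "decidable P"
  shows "decidable (\<lambda>n. \<not> P n)"
proof -
  have "computable (\<lambda>n. if P n then 0 else 1)" using assms by (intro comp_intros)
  then show ?thesis unfolding decidable_def by (rule computable_cong) simp
qed

lemma decidable_conj [comp_intros]:
  assumes "decidable P" "decidable Q"
  shows "decidable (\<lambda>n. P n \<and> Q n)"
proof -
  have "computable (\<lambda>n. if P n then (if Q n then 1 else 0) else 0)"
    using assms by (intro comp_intros)
  then show ?thesis unfolding decidable_def by (rule computable_cong) simp
qed

lemma decidable_nat_eq [comp_intros]:
  "computable f \<Longrightarrow> computable g \<Longrightarrow> decidable (\<lambda>n. (f n :: nat) = g n)"
  unfolding order_eq_iff by (intro comp_intros)

lemma decidable_bex [comp_intros]:
  assumes "computable k" "decidable (\<lambda>p. P (p1 p) (p2 p))"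
  shows "decidable (\<lambda>n. \<exists>i<k n. P n i)"
proof -
  have "decidable (\<lambda>n. 0 < (\<Sum>i<k n. if P n i then 1 else 0 :: nat))"
    by (intro comp_intros assms)
  moreover have "0 < (\<Sum>i<k n. if P n i then 1 else 0 :: nat) \<longleftrightarrow> (\<exists>i<k n. P n i)" for n
    by (subst neq0_conv[symmetric], subst sum_eq_0_iff) auto
  ultimately show ?thesis by (simp only:)
qed

lemma computable_div [comp_intros]:
  assumes "computable f" "computable g"
  shows "computable (\<lambda>n. f n div g n)"
proof -
  \<comment> \<open>The quotient counts the positive multiples of \<open>b\<close> up to
    \<open>a\<close>. For \<open>b = 0\<close> every index would count, hence the separate
    case.\<close>
  have eq: "a div b = (if b = 0 then 0 else \<Sum>i<a. if Suc i * b \<le> a then 1 else 0)" for a b :: nat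
  proof (cases "b = 0")
    case False
    have "i < a \<and> Suc i * b \<le> a \<longleftrightarrow> i < a div b" for i
    proof -
      have "Suc i * b \<le> a \<longleftrightarrow> i < a div b"
        using False less_eq_div_iff_mult_less_eq[of b "Suc i" a] by (simp add: Suc_le_eq)
      then show ?thesis using div_le_dividend[of a b] by linarith
    qed
    then have "{i. i < a \<and> Suc i * b \<le> a} = {..<a div b}"
      by blast
    then have "(\<Sum>i<a. if Suc i * b \<le> a then 1 else 0) = a div b"
      by (simp add: sum.If_cases Int_def lessThan_def)
    then show ?thesis using False by simp
  qed simp
  show ?thesis unfolding eq[of "f _" "g _"]
    by (intro comp_intros assms computable_comp[OF assms(1)] computable_comp[OF assms(2)])
qed

lemma computable_mod [comp_intros]:
  "computable f \<Longrightarrow> computable g \<Longrightarrow> computable (\<lambda>n. f n mod g n)" for f g :: "nat \<Rightarrow> nat"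
  unfolding minus_div_mult_eq_mod[symmetric] by (intro comp_intros)

section \<open>Evaluation with bounded searches\<close>

text \<open>Evaluation with fuel \<open>t\<close>, which only bounds the searches of \<open>Mn\<close>. The value \<open>0\<close> stands for
  ``no result'', \<open>Suc y\<close> for the result \<open>y\<close>. The search keeps \<open>0\<close> while it runs, \<open>1\<close> after
  it met an undefined value, and \<open>Suc (Suc y)\<close> after it found \<open>y\<close>.\<close>

fun beval :: "recf \<Rightarrow> nat \<Rightarrow> nat list \<Rightarrow> nat" where
  "beval Zero t xs = 1"
| "beval Succ t xs = (case xs of [] \<Rightarrow> 0 | x # _ \<Rightarrow> Suc (Suc x))"
| "beval (Proj i) t xs = (if i < length xs then Suc (xs ! i) else 0)"
| "beval (Comp f gs) t xs =
    (if 0 \<in> set (map (\<lambda>g. beval g t xs) gs) then 0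
     else beval f t (map (\<lambda>g. beval g t xs - 1) gs))"
| "beval (Prim f g) t xs = (case xs of [] \<Rightarrow> 0 | k # ys \<Rightarrow>
    rec_nat (beval f t ys) (\<lambda>i r. if r = 0 then 0 else beval g t ((r - 1) # i # ys)) k)"
| "beval (Mn f) t xs =
    rec_nat 0 (\<lambda>i r. if r = 0
      then (if beval f t (i # xs) = 0 then 1 else if beval f t (i # xs) = 1 then Suc (Suc i) else 0)
      else r) t - 1"

definition mn_search :: "(nat \<Rightarrow> nat) \<Rightarrow> nat \<Rightarrow> nat" where
  "mn_search h = rec_nat 0 (\<lambda>i r. if r = 0
      then (if h i = 0 then 1 else if h i = 1 then Suc (Suc i) else 0) else r)"

lemma mn_search_0: "mn_search h k = 0 \<longleftrightarrow> (\<forall>i<k. h i > 1)"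
  unfolding mn_search_def by (induction k) (auto simp: less_Suc_eq)

lemma mn_search_found: "mn_search h k = Suc (Suc y) \<longleftrightarrow> y < k \<and> h y = 1 \<and> (\<forall>i<y. h i > 1)"
proof (induction k)
  case (Suc k)
  have S: "mn_search h (Suc k) = (if mn_search h k = 0
      then (if h k = 0 then 1 else if h k = 1 then Suc (Suc k) else 0) else mn_search h k)"
    by (simp add: mn_search_def)
  show ?case
    using Suc mn_search_0[of h k] unfolding S by (auto simp: less_Suc_eq)
qed (simp add: mn_search_def)

lemma beval_Mn: "beval (Mn f) t xs = mn_search (\<lambda>i. beval f t (i # xs)) t - 1"
  by (simp add: mn_search_def)

lemma beval_sound: "beval c t xs = Suc y \<Longrightarrow> eval c xs y"
proof (induction c arbitrary: xs y)
  case Zero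
  then show ?case by (auto intro: eval_Zero)
next
  case Succ
  then show ?case by (auto intro: eval_Succ split: list.splits)
next
  case (Proj i)
  then show ?case by (auto intro: eval_Proj split: if_splits)
next
  case (Comp f gs)
  have "eval g xs (beval g t xs - 1)" if "g \<in> set gs" for g
  proof (rule Comp.IH(2)[OF that])
    show "beval g t xs = Suc (beval g t xs - 1)"
      using Comp.prems that by (auto split: if_splits simp: image_iff)
  qed
  then have "list_all2 (\<lambda>g y. eval g xs y) gs (map (\<lambda>g. beval g t xs - 1) gs)"
    by (simp add: list_all2_conv_all_nth)
  moreover have "eval f (map (\<lambda>g. beval g t xs - 1) gs) y"
    using Comp.prems by (intro Comp.IH(1)) (auto split: if_splits)
  ultimately show ?case by (rule eval_Comp)
next
  case (Prim f g)
  then obtain k ys where xs: "xs = k # ys" by (auto split: list.splits)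
  have "rec_nat (beval f t ys) (\<lambda>i r. if r = 0 then 0 else beval g t ((r - 1) # i # ys)) k = Suc y
    \<Longrightarrow> eval (Prim f g) (k # ys) y" for k y
  proof (induction k arbitrary: y)
    case 0
    then show ?case by (auto intro: eval_Prim0 Prim.IH(1))
  next
    case (Suc k)
    define r where "r = rec_nat (beval f t ys)
      (\<lambda>i r. if r = 0 then 0 else beval g t ((r - 1) # i # ys)) k"
    have r: "r \<noteq> 0" "beval g t ((r - 1) # k # ys) = Suc y"
      using Suc.prems by (auto simp: r_def split: if_splits)
    then have "eval (Prim f g) (k # ys) (r - 1)" by (intro Suc.IH) (simp add: r_def)
    then show ?case using Prim.IH(2)[OF r(2)] by (rule eval_PrimS)
  qed
  then show ?case using Prim.prems xs by simp
next
  case (Mn f)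
  then have "mn_search (\<lambda>i. beval f t (i # xs)) t = Suc (Suc y)"
    by (simp add: beval_Mn del: beval.simps)
  then have a: "beval f t (y # xs) = 1" "\<forall>i<y. beval f t (i # xs) > 1"
    by (auto simp: mn_search_found)
  show ?case
  proof (rule eval_Mn)
    show "eval f (y # xs) 0" using a by (intro Mn.IH) simp
    show "\<forall>y'<y. \<exists>v. eval f (y' # xs) v \<and> v > 0"
    proof (intro allI impI)
      fix i assume "i < y"
      then have "beval f t (i # xs) = Suc (beval f t (i # xs) - 1)" "beval f t (i # xs) - 1 > 0"
        using a(2) by (auto simp: less_imp_Suc_add)
      then show "\<exists>v. eval f (i # xs) v \<and> v > 0" using Mn.IH by blast
    qed
  qed
qed

lemma beval_complete:
  "eval c xs y \<Longrightarrow> \<forall>\<^sub>F t in sequentially. beval c t xs = Suc y"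
proof (induction rule: eval.induct)
  case (eval_Comp xs gs ys f z)
  have "\<forall>\<^sub>F t in sequentially. map (\<lambda>g. beval g t xs) gs = map Suc ys"
    using eval_Comp(1)
  proof (induction rule: list_all2_induct)
    case (Cons g gs y ys)
    from Cons(1) have "\<forall>\<^sub>F t in sequentially. beval g t xs = Suc y" by simp
    with Cons(3) show ?case by eventually_elim simp
  qed simp
  moreover have "\<forall>\<^sub>F t in sequentially. beval f t ys = Suc z" by (fact eval_Comp.IH)
  ultimately show ?case
  proof eventually_elim
    case (elim t)
    have "map (\<lambda>g. beval g t xs - 1) gs = map (\<lambda>v. v - 1) (map (\<lambda>g. beval g t xs) gs)"
      by simp
    also have "\<dots> = ys" unfolding elim by (simp add: o_def)
    finally have "map (\<lambda>g. beval g t xs - 1) gs = ys" .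
    moreover have "0 \<notin> set (map (\<lambda>g. beval g t xs) gs)" unfolding elim by auto
    ultimately show ?case using elim by simp
  qed
next
  case (eval_PrimS f g n xs y z)
  from eval_PrimS.IH show ?case by eventually_elim simp
next
  case (eval_Mn f y xs)
  have "\<forall>\<^sub>F t in sequentially. \<forall>i\<in>{..<y}. beval f t (i # xs) > 1"
  proof (rule eventually_ball_finite, simp, rule ballI)
    fix i assume "i \<in> {..<y}"
    then obtain v where v: "v > 0" "\<forall>\<^sub>F t in sequentially. beval f t (i # xs) = Suc v"
      using eval_Mn by blast
    from v(2) show "\<forall>\<^sub>F t in sequentially. beval f t (i # xs) > 1"
      by eventually_elim (simp add: v)
  qed
  with eval_Mn(2) eventually_gt_at_top[of y] show ?case
  proof eventually_elim
    case (elim t)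
    then have "mn_search (\<lambda>i. beval f t (i # xs)) t = Suc (Suc y)"
      by (subst mn_search_found) auto
    then show ?case by (simp add: beval_Mn del: beval.simps)
  qed
qed auto

lemma eval_iff_beval: "eval c xs y \<longleftrightarrow> (\<exists>t. beval c t xs = Suc y)"
  using beval_sound[of c _ xs y] eventually_happens[OF beval_complete[of c xs y]] by auto

lemma eval_deterministic:
  assumes "eval c xs y" "eval c xs z"
  shows "y = z"
proof -
  have "\<forall>\<^sub>F t in sequentially. Suc y = Suc z"
    using beval_complete[OF assms(1)] beval_complete[OF assms(2)] by eventually_elim simp
  then show ?thesis by simp
qed

lemma cfun_if0:
  assumes "cfun n p" "cfun n f" "cfun n g"
  shows "cfun n (\<lambda>xs. if p xs = 0 then f xs else g xs)"
proof -
  have "cfun n (\<lambda>xs. (1 - p xs) * f xs + (1 - (1 - p xs)) * g xs)"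
    by (intro cfun_add cfun_mult cfun_diff cfun_const assms)
  then show ?thesis by (rule iffD1[OF cfun_cong, rotated]) simp
qed

lemma cfun_comp_cong:
  assumes "cfun (length gs) f" "\<And>g. g \<in> set gs \<Longrightarrow> cfun n g"
    and "\<And>xs. length xs = n \<Longrightarrow> h xs = f (map (\<lambda>g. g xs) gs)"
  shows "cfun n h"
  using cfun_comp[OF assms(1,2)] cfun_cong[of n h, OF assms(3)] by blast

lemma map_nth_upt: "map (\<lambda>i. xs ! i) [k..<length xs] = drop k xs"
  by (rule nth_equalityI) auto

text \<open>Fuel turns every search into a bounded recursion, so for a fixed program the evaluator
  is built by induction on that program and no universal function is required. The arity stays
  arbitrary because \<open>Prim\<close> and \<open>Mn\<close> call their parts with other numbers of
  arguments.\<close>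

lemma cfun_beval: "cfun (Suc n) (\<lambda>zs. beval c (zs ! 0) (tl zs))"
proof (induction c arbitrary: n)
  case Zero
  then show ?case using cfun_const[of "Suc n" 1] by simp
next
  case Succ
  show ?case
  proof (cases n)
    case 0
    then show ?thesis
      by (intro iffD1[OF cfun_cong cfun_zero]) (auto simp: length_Suc_conv)
  next
    case (Suc m)
    have "cfun (Suc n) (\<lambda>zs. Suc (Suc (zs ! 1)))" by (intro cfun_Suc cfun_nth) (simp add: Suc)
    then show ?thesis
      by (rule iffD1[OF cfun_cong, rotated]) (auto simp: length_Suc_conv Suc)
  qed
next
  case (Proj i)
  show ?case
  proof (cases "i < n")
    case True
    then have "cfun (Suc n) (\<lambda>zs. Suc (zs ! Suc i))" by (intro cfun_Suc cfun_nth) simp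
    then show ?thesis
      by (rule iffD1[OF cfun_cong, rotated]) (use True in \<open>auto simp: length_Suc_conv\<close>)
  next
    case False
    then show ?thesis
      by (intro iffD1[OF cfun_cong cfun_zero]) (auto simp: length_Suc_conv)
  qed
next
  case (Comp f gs)
  have gs: "cfun (Suc n) (\<lambda>zs. beval g (zs ! 0) (tl zs))" if "g \<in> set gs" for g
    using Comp.IH(2)[OF that] .
  then have 1: "cfun (Suc n) (\<lambda>zs. if 0 \<in> set (map (\<lambda>g. beval g (zs ! 0) (tl zs)) gs) then 0 else 1)"
  proof (induction gs)
    case Nil
    then show ?case using cfun_const[of "Suc n" 1] by simp
  next
    case (Cons g gs)
    have "cfun (Suc n) (\<lambda>zs. if beval g (zs ! 0) (tl zs) = 0 then 0 else
      if 0 \<in> set (map (\<lambda>g. beval g (zs ! 0) (tl zs)) gs) then 0 else 1)"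
      by (intro cfun_if0 cfun_zero Cons) (auto intro: Cons.prems)
    then show ?case by (rule iffD1[OF cfun_cong, rotated]) auto
  qed
  have 2: "cfun (Suc n) (\<lambda>zs. beval f (zs ! 0) (map (\<lambda>g. beval g (zs ! 0) (tl zs) - 1) gs))"
  proof (rule cfun_comp_cong)
    show "cfun (length ((\<lambda>zs. zs ! 0) # map (\<lambda>g zs. beval g (zs ! 0) (tl zs) - 1) gs))
      (\<lambda>zs. beval f (zs ! 0) (tl zs))"
      using Comp.IH(1)[of "length gs"] by simp
    show "cfun (Suc n) h" if "h \<in> set ((\<lambda>zs. zs ! 0) # map (\<lambda>g zs. beval g (zs ! 0) (tl zs) - 1) gs)"
      for h
      using that by (auto intro: cfun_nth cfun_pred[simplified] gs)
  qed (simp add: o_def)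
  from cfun_if0[OF 1 cfun_zero 2] show ?case
    by (rule iffD1[OF cfun_cong, rotated]) auto
next
  case (Prim f g)
  show ?case
  proof (cases n)
    case 0
    then show ?thesis
      by (intro iffD1[OF cfun_cong cfun_zero]) (auto simp: length_Suc_conv)
  next
    case (Suc m)
    have 1: "cfun (Suc n) (\<lambda>zs. beval f (zs ! 0) (drop 2 zs))"
    proof (rule cfun_comp_cong)
      show "cfun (length ((\<lambda>zs. zs ! 0) # map (\<lambda>i zs. zs ! i) [2..<Suc n]))
        (\<lambda>zs. beval f (zs ! 0) (tl zs))"
        using Prim.IH(1)[of m] by (simp add: Suc del: upt_Suc)
      show "cfun (Suc n) h" if "h \<in> set ((\<lambda>zs. zs ! 0) # map (\<lambda>i zs. zs ! i) [2..<Suc n])" for h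
        using that by (auto intro: cfun_nth)
      show "beval f (zs ! 0) (drop 2 zs) = beval f (map (\<lambda>g. g zs)
          ((\<lambda>zs. zs ! 0) # map (\<lambda>i zs. zs ! i) [2..<Suc n]) ! 0)
          (tl (map (\<lambda>g. g zs) ((\<lambda>zs. zs ! 0) # map (\<lambda>i zs. zs ! i) [2..<Suc n])))"
        if "length zs = Suc n" for zs
        using map_nth_upt[of zs 2] that by (simp add: o_def)
    qed
    \<comment> \<open>Inside the recursion the list is \<open>r # i # t # k # ys\<close>: value so
      far, counter, fuel, then the original arguments. This explains the indices and
      \<open>drop 4\<close>. For \<open>Mn\<close> below it is
      \<open>r # i # t # xs\<close>.\<close>
    have 2: "cfun (Suc (Suc (Suc n))) (\<lambda>zs. beval g (zs ! 2) ((zs ! 0 - 1) # zs ! 1 # drop 4 zs))"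
    proof (rule cfun_comp_cong)
      let ?L = "(\<lambda>zs. zs ! 2) # (\<lambda>zs. zs ! 0 - 1) # (\<lambda>zs. zs ! 1) #
        map (\<lambda>i zs. zs ! i) [4..<Suc (Suc (Suc n))]"
      show "cfun (length ?L) (\<lambda>zs. beval g (zs ! 0) (tl zs))"
        using Prim.IH(2)[of "Suc (Suc m)"] by (simp add: Suc del: upt_Suc)
      show "cfun (Suc (Suc (Suc n))) h" if "h \<in> set ?L" for h
        using that by (auto intro: cfun_nth cfun_pred[simplified])
      show "beval g (zs ! 2) ((zs ! 0 - 1) # zs ! 1 # drop 4 zs)
          = beval g (map (\<lambda>g. g zs) ?L ! 0) (tl (map (\<lambda>g. g zs) ?L))"
        if "length zs = Suc (Suc (Suc n))" for zs
        using map_nth_upt[of zs 4] that by (simp add: o_def)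
    qed
    have "cfun (Suc n) (\<lambda>zs. rec_nat (beval f (zs ! 0) (drop 2 zs)) (\<lambda>i r.
      (\<lambda>zs. if zs ! 0 = 0 then 0 else beval g (zs ! 2) ((zs ! 0 - 1) # zs ! 1 # drop 4 zs)) (r # i # zs))
        (zs ! 1))"
      by (intro cfun_rec 1 cfun_if0 2 cfun_nth cfun_zero) (auto simp: Suc)
    then show ?thesis
      by (rule iffD1[OF cfun_cong, rotated])
        (auto simp: length_Suc_conv Suc numeral_2_eq_2 eval_nat_numeral cong: if_cong)
  qed
next
  case (Mn f)
  have 1: "cfun (Suc (Suc (Suc n))) (\<lambda>zs. beval f (zs ! 2) (zs ! 1 # drop 3 zs))"
  proof (rule cfun_comp_cong)
    let ?L = "(\<lambda>zs. zs ! 2) # (\<lambda>zs. zs ! 1) # map (\<lambda>i zs. zs ! i) [3..<Suc (Suc (Suc n))]"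
    show "cfun (length ?L) (\<lambda>zs. beval f (zs ! 0) (tl zs))"
      using Mn.IH[of "Suc n"] by (simp del: upt_Suc)
    show "cfun (Suc (Suc (Suc n))) h" if "h \<in> set ?L" for h
      using that by (auto intro: cfun_nth)
    show "beval f (zs ! 2) (zs ! 1 # drop 3 zs)
        = beval f (map (\<lambda>g. g zs) ?L ! 0) (tl (map (\<lambda>g. g zs) ?L))"
      if "length zs = Suc (Suc (Suc n))" for zs
      using map_nth_upt[of zs 3] that by (simp add: o_def)
  qed
  \<comment> \<open>\<open>cfun_if0\<close> branches on zero only, so the test for the value 1
    becomes a test of the predecessor once 0 has been excluded.\<close>
  have "cfun (Suc n) (\<lambda>zs. rec_nat 0 (\<lambda>i r. (\<lambda>zs. if zs ! 0 = 0 then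
      (if beval f (zs ! 2) (zs ! 1 # drop 3 zs) = 0 then 1 else
       if beval f (zs ! 2) (zs ! 1 # drop 3 zs) - 1 = 0 then Suc (Suc (zs ! 1)) else 0)
      else zs ! 0) (r # i # zs)) (zs ! 0) - 1)"
    by (intro cfun_pred cfun_rec 1 cfun_if0 cfun_nth cfun_zero cfun_const cfun_Suc) auto
  then show ?case
  proof (rule iffD1[OF cfun_cong, rotated], goal_cases)
    case (1 zs)
    then obtain t xs where zs: "zs = t # xs" by (auto simp: length_Suc_conv)
    have "(\<lambda>i r. (\<lambda>zs. if zs ! 0 = 0 then
        (if beval f (zs ! 2) (zs ! 1 # drop 3 zs) = 0 then 1 else
         if beval f (zs ! 2) (zs ! 1 # drop 3 zs) - 1 = 0 then Suc (Suc (zs ! 1)) else 0)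
        else zs ! 0) (r # i # zs))
      = (\<lambda>i r. if r = 0
        then (if beval f t (i # xs) = 0 then 1 else if beval f t (i # xs) = 1 then Suc (Suc i) else 0)
        else r)"
      unfolding zs by (intro ext) (auto simp: eval_nat_numeral)
    then show ?case unfolding beval.simps by (simp only: zs nth_Cons_0 list.sel)
  qed
qed

section \<open>Decidable predicates and c.e. sets\<close>

lemma ce_set_decidable:
  assumes "decidable P"
  shows "ce_set {n. P n}"
proof -
  have "decidable (\<lambda>n. \<not> P n)" by (intro comp_intros assms)
  then have "computable (\<lambda>n. if P n then 0 else 1)"
    unfolding decidable_def by (rule computable_cong) simp
  then have "cfun 2 (\<lambda>xs. if P (xs ! 1) then 0 else 1)"
    by (rule cfun_comp1) (simp add: cfun_nth)
  then obtain c where c: "\<And>xs. length xs = 2 \<Longrightarrow> eval c xs (if P (xs ! 1) then 0 else 1)"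
    unfolding cfun_def by blast
  \<comment> \<open>The test computed by \<open>c\<close> ignores the search variable, so the search
    stops at 0 or never.\<close>
  have "P n \<longleftrightarrow> (\<exists>y. eval (Mn c) [n] y)" for n
  proof
    assume "P n"
    then have "eval (Mn c) [n] 0"
      using c[of "[0, n]"] by (intro eval_Mn) auto
    then show "\<exists>y. eval (Mn c) [n] y" ..
  next
    assume "\<exists>y. eval (Mn c) [n] y"
    then obtain y where "eval c [y, n] 0" by (auto elim: eval.cases)
    with c[of "[y, n]"] eval_deterministic show "P n" by (fastforce split: if_splits)
  qed
  then show ?thesis unfolding ce_set_def by blast
qed

text \<open>Stages are not claimed to be increasing in \<open>t\<close>. Permanence from some stage
  on is what \<open>beval_complete\<close> delivers, and it suffices for finding an enumerated
  string at any sufficiently large stage.\<close>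

lemma ce_set_decidable_stages:
  assumes "ce_set A"
  obtains P where "decidable (\<lambda>p. P (p1 p) (p2 p))" "\<And>x. x \<in> A \<longleftrightarrow> (\<exists>s. \<forall>t\<ge>s. P x t)"
    "\<And>x t. P x t \<Longrightarrow> x \<in> A"
proof -
  obtain c where c: "\<And>x. x \<in> A \<longleftrightarrow> (\<exists>y. eval c [x] y)" using assms unfolding ce_set_def by blast
  define P where "P x t \<longleftrightarrow> 0 < beval c t [x]" for x t
  have "cfun 2 (\<lambda>zs. beval c (zs ! 0) [zs ! 1])"
    using cfun_beval[of 1 c] unfolding numeral_2_eq_2 One_nat_def
    by (rule iffD1[OF cfun_cong, rotated]) (auto simp: length_Suc_conv)
  from cfun_comp2[OF this]
  have "computable (\<lambda>p. beval c (p2 p) [p1 p])"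
    using computable_p1 computable_p2 unfolding computable_cfun by blast
  then have "decidable (\<lambda>p. P (p1 p) (p2 p))" unfolding P_def by (intro comp_intros)
  moreover have "P x t \<Longrightarrow> x \<in> A" for x t
    unfolding P_def c eval_iff_beval by (metis gr0_implies_Suc)
  moreover have "\<exists>s. \<forall>t\<ge>s. P x t" if x: "x \<in> A" for x
  proof -
    obtain y where "eval c [x] y" using x c[of x] by auto
    from beval_complete[OF this] have "\<forall>\<^sub>F t in sequentially. P x t"
      unfolding P_def by eventually_elim simp
    then show ?thesis unfolding eventually_sequentially .
  qed
  ultimately show thesis using that by blast
qed

section \<open>Computable sequences of rationals and left-c.e. reals\<close>

lemma rat_nat_fraction:
  obtains a b d where "(r::rat) = (of_nat a - of_nat b) / of_nat (Suc d)"
proof -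
  obtain p s where r: "r = of_int p / of_int s" "s > 0"
    by (metis quotient_of_div quotient_of_denom_pos prod.exhaust)
  have "of_int p = (of_nat (nat p) - of_nat (nat (- p)) :: rat)"
    by (cases "p \<ge> 0") (simp_all add: of_nat_nat)
  moreover have "of_int s = (of_nat (Suc (nat (s - 1))) :: rat)"
    using r(2) by (simp add: of_nat_nat)
  ultimately show thesis using that r(1) by metis
qed

lemma rat_seqE:
  assumes "computable_rat_seq q"
  obtains a b d where "computable a" "computable b" "computable d"
    "\<And>n. q n = (of_nat (a n) - of_nat (b n)) / of_nat (Suc (d n))"
  using assms unfolding computable_rat_seq_def by blast

lemma rat_seqI:
  assumes "computable a" "computable b" "computable d"
    "\<And>n. q n = (of_nat (a n) - of_nat (b n)) / of_nat (Suc (d n))"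
  shows "computable_rat_seq q"
  using assms unfolding computable_rat_seq_def by blast

lemma rat_seq_const [comp_intros]: "computable_rat_seq (\<lambda>_. r)"
proof -
  obtain a b d where "r = (of_nat a - of_nat b) / of_nat (Suc d)" by (rule rat_nat_fraction)
  then show ?thesis by (intro rat_seqI[of "\<lambda>_. a" "\<lambda>_. b" "\<lambda>_. d"] comp_intros)
qed

lemma rat_seq_of_nat [comp_intros]:
  "computable f \<Longrightarrow> computable_rat_seq (\<lambda>n. of_nat (f n))"
  by (rule rat_seqI[of f "\<lambda>_. 0" "\<lambda>_. 0"]) (auto intro: comp_intros)

lemma rat_seq_comp:
  assumes "computable_rat_seq q" "computable f"
  shows "computable_rat_seq (\<lambda>n. q (f n))"
proof -
  from assms(1) obtain a b d where q: "computable a" "computable b" "computable d"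
    "\<And>n. q n = (of_nat (a n) - of_nat (b n)) / of_nat (Suc (d n))" using rat_seqE by blast
  show ?thesis
    by (rule rat_seqI[OF q(1-3)[THEN computable_comp, OF assms(2)]]) (rule q(4))
qed

lemma rat_seq2:
  assumes "computable_rat_seq (\<lambda>p. q (p1 p) (p2 p))" "computable f" "computable g"
  shows "computable_rat_seq (\<lambda>n. q (f n) (g n))"
  using rat_seq_comp[OF assms(1) computable_pair[OF assms(2,3)]] by simp

lemma rat_seq_add [comp_intros]:
  assumes "computable_rat_seq q" "computable_rat_seq r"
  shows "computable_rat_seq (\<lambda>n. q n + r n)"
proof -
  from assms(1) obtain a b d where q: "computable a" "computable b" "computable d"
    "\<And>n. q n = (of_nat (a n) - of_nat (b n)) / of_nat (Suc (d n))" using rat_seqE by blast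
  from assms(2) obtain a' b' d' where r: "computable a'" "computable b'" "computable d'"
    "\<And>n. r n = (of_nat (a' n) - of_nat (b' n)) / of_nat (Suc (d' n))" using rat_seqE by blast
  show ?thesis
  proof (rule rat_seqI)
    show "computable (\<lambda>n. a n * Suc (d' n) + a' n * Suc (d n))"
      "computable (\<lambda>n. b n * Suc (d' n) + b' n * Suc (d n))"
      "computable (\<lambda>n. d n * d' n + d n + d' n)"
      by (intro comp_intros q r)+
    fix n
    have "of_nat (Suc (d n * d' n + d n + d' n)) = (of_nat (Suc (d n)) * of_nat (Suc (d' n)) :: rat)"
      by (simp add: algebra_simps)
    moreover have "of_nat (Suc (d n)) \<noteq> (0::rat)" "of_nat (Suc (d' n)) \<noteq> (0::rat)"
      by (simp_all only: of_nat_eq_0_iff)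
    ultimately show "q n + r n = (of_nat (a n * Suc (d' n) + a' n * Suc (d n))
        - of_nat (b n * Suc (d' n) + b' n * Suc (d n))) / of_nat (Suc (d n * d' n + d n + d' n))"
      unfolding q(4) r(4) of_nat_add of_nat_mult
      by (simp add: add_frac_eq del: of_nat_Suc) (simp add: algebra_simps del: of_nat_Suc)
  qed
qed

lemma rat_seq_mult [comp_intros]:
  assumes "computable_rat_seq q" "computable_rat_seq r"
  shows "computable_rat_seq (\<lambda>n. q n * r n)"
proof -
  from assms(1) obtain a b d where q: "computable a" "computable b" "computable d"
    "\<And>n. q n = (of_nat (a n) - of_nat (b n)) / of_nat (Suc (d n))" using rat_seqE by blast
  from assms(2) obtain a' b' d' where r: "computable a'" "computable b'" "computable d'"
    "\<And>n. r n = (of_nat (a' n) - of_nat (b' n)) / of_nat (Suc (d' n))" using rat_seqE by blast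
  show ?thesis
  proof (rule rat_seqI)
    show "computable (\<lambda>n. a n * a' n + b n * b' n)" "computable (\<lambda>n. a n * b' n + b n * a' n)"
      "computable (\<lambda>n. d n * d' n + d n + d' n)"
      by (intro comp_intros q r)+
    fix n
    have "of_nat (Suc (d n * d' n + d n + d' n)) = (of_nat (Suc (d n)) * of_nat (Suc (d' n)) :: rat)"
      by (simp add: algebra_simps)
    then show "q n * r n = (of_nat (a n * a' n + b n * b' n) - of_nat (a n * b' n + b n * a' n))
        / of_nat (Suc (d n * d' n + d n + d' n))"
      unfolding q(4) r(4) of_nat_add of_nat_mult
      by (simp add: algebra_simps del: of_nat_Suc)
  qed
qed

lemma rat_seq_uminus [comp_intros]:
  assumes "computable_rat_seq q"
  shows "computable_rat_seq (\<lambda>n. - q n)"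
  using rat_seq_mult[OF rat_seq_const[of "- 1"] assms] by simp

lemma rat_seq_diff [comp_intros]:
  assumes "computable_rat_seq q" "computable_rat_seq r"
  shows "computable_rat_seq (\<lambda>n. q n - r n)"
  using rat_seq_add[OF assms(1) rat_seq_uminus[OF assms(2)]] by simp

lemma rat_seq_inverse_power2 [comp_intros]:
  assumes "computable f"
  shows "computable_rat_seq (\<lambda>n. 1 / 2 ^ f n)"
proof (rule rat_seqI)
  show "computable (\<lambda>_. 1)" "computable (\<lambda>_. 0)" "computable (\<lambda>n. 2 ^ f n - 1)"
    by (intro comp_intros assms)+
qed simp

lemma rat_seq_if [comp_intros]:
  assumes "decidable P" "computable_rat_seq q" "computable_rat_seq r"
  shows "computable_rat_seq (\<lambda>n. if P n then q n else r n)"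
proof -
  from assms(2) obtain a b d where q: "computable a" "computable b" "computable d"
    "\<And>n. q n = (of_nat (a n) - of_nat (b n)) / of_nat (Suc (d n))" using rat_seqE by blast
  from assms(3) obtain a' b' d' where r: "computable a'" "computable b'" "computable d'"
    "\<And>n. r n = (of_nat (a' n) - of_nat (b' n)) / of_nat (Suc (d' n))" using rat_seqE by blast
  show ?thesis
  proof (rule rat_seqI)
    show "computable (\<lambda>n. if P n then a n else a' n)" "computable (\<lambda>n. if P n then b n else b' n)"
      "computable (\<lambda>n. if P n then d n else d' n)"
      by (intro comp_intros q r assms)+
  qed (simp add: q(4) r(4))
qed

lemma decidable_rat_le [comp_intros]:
  assumes "computable_rat_seq q" "computable_rat_seq r"
  shows "decidable (\<lambda>n. q n \<le> r n)"
proof -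
  from assms(1) obtain a b d where q: "computable a" "computable b" "computable d"
    "\<And>n. q n = (of_nat (a n) - of_nat (b n)) / of_nat (Suc (d n))" using rat_seqE by blast
  from assms(2) obtain a' b' d' where r: "computable a'" "computable b'" "computable d'"
    "\<And>n. r n = (of_nat (a' n) - of_nat (b' n)) / of_nat (Suc (d' n))" using rat_seqE by blast
  \<comment> \<open>Cross-multiplication, with the negative parts moved to the other side so that
    natural numbers are compared without truncated subtraction.\<close>
  have "q n \<le> r n \<longleftrightarrow>
      a n * Suc (d' n) + b' n * Suc (d n) \<le> a' n * Suc (d n) + b n * Suc (d' n)" for n
  proof -
    have pos: "(0::rat) < of_nat (Suc (d n))" "(0::rat) < of_nat (Suc (d' n))"
      by (simp_all only: of_nat_0_less_iff)
    have "q n \<le> r n \<longleftrightarrow> (of_nat (a n) - of_nat (b n)) * of_nat (Suc (d' n))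
        \<le> (of_nat (a' n) - of_nat (b' n)) * (of_nat (Suc (d n)) :: rat)"
      unfolding q(4) r(4) using pos by (simp add: divide_simps del: of_nat_Suc)
    also have "\<dots> \<longleftrightarrow> (of_nat (a n * Suc (d' n) + b' n * Suc (d n)) :: rat)
        \<le> of_nat (a' n * Suc (d n) + b n * Suc (d' n))"
      unfolding of_nat_add of_nat_mult by (auto simp: algebra_simps)
    finally show ?thesis unfolding of_nat_le_iff .
  qed
  moreover have "decidable (\<lambda>n. a n * Suc (d' n) + b' n * Suc (d n)
      \<le> a' n * Suc (d n) + b n * Suc (d' n))"
    by (intro comp_intros q r)
  ultimately show ?thesis by presburger
qed

lemma decidable_rat_less [comp_intros]:
  assumes "computable_rat_seq q" "computable_rat_seq r"
  shows "decidable (\<lambda>n. q n < r n)"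
  unfolding not_le[symmetric] by (intro comp_intros assms)

text \<open>Ties go to the first maximum between \<open>s\<close> and \<open>v\<close>. The value is \<open>s\<close> if \<open>v < s\<close>.\<close>

definition argmax :: "(nat \<Rightarrow> 'a::linorder) \<Rightarrow> nat \<Rightarrow> nat \<Rightarrow> nat" where
  "argmax w s v = rec_nat s (\<lambda>i r. if s < Suc i \<and> w r < w (Suc i) then Suc i else r) v"

lemma argmax_0 [simp]: "argmax w s 0 = s"
  by (simp add: argmax_def)

lemma argmax_Suc: "argmax w s (Suc v) =
  (if s < Suc v \<and> w (argmax w s v) < w (Suc v) then Suc v else argmax w s v)"
  by (simp add: argmax_def)

lemma argmax_start: "v \<le> s \<Longrightarrow> argmax w s v = s"
  by (induction v) (auto simp: argmax_Suc)

lemma argmax_bounds: "s \<le> v \<Longrightarrow> s \<le> argmax w s v \<and> argmax w s v \<le> v"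
proof (induction v)
  case (Suc v)
  then show ?case by (cases "s \<le> v") (auto simp: argmax_Suc argmax_start)
qed simp

lemma argmax_ge: "s \<le> u \<Longrightarrow> u \<le> v \<Longrightarrow> w u \<le> w (argmax w s v)"
proof (induction v)
  case (Suc v)
  show ?case
  proof (cases "u = Suc v")
    case True
    with Suc.prems show ?thesis using argmax_start[of v s w]
      by (cases "s = Suc v") (auto simp: argmax_Suc)
  next
    case False
    then show ?thesis using Suc by (auto simp: argmax_Suc)
  qed
qed simp

lemma computable_argmax:
  assumes w: "computable_rat_seq (\<lambda>p. w (p1 p) (p2 p))" and "computable f" "computable g"
    and "computable h"
  shows "computable (\<lambda>n. argmax (w (f n)) (g n) (h n))"
  unfolding argmax_def
  by (intro computable_rec rat_seq2[OF w] computable_comp[OF assms(2)] computable_comp[OF assms(3)]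
      comp_intros assms)

text \<open>The running maxima from stage \<open>N\<close> on increase and are squeezed between
  \<open>w\<close> and \<open>x\<close>. Read contrapositively, any computable approximation of a
  real that is not left-c.e. overshoots its limit again and again.\<close>

lemma left_ce_lower_limit:
  assumes w: "computable_rat_seq w" "(\<lambda>s. real_of_rat (w s)) \<longlonglongrightarrow> x"
    and below: "\<And>s. s \<ge> N \<Longrightarrow> real_of_rat (w s) \<le> x"
  shows "left_ce x"
proof -
  define q where "q s = w (argmax w N (N + s))" for s
  have "computable_rat_seq (\<lambda>p. w (p2 p))" by (intro rat_seq_comp[OF w(1)] comp_intros)
  then have "computable (\<lambda>s. argmax w N (N + s))"
    by (rule computable_argmax[where f = "\<lambda>_. 0" and g = "\<lambda>_. N" and h = "\<lambda>s. N + s"])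
      (intro comp_intros)+
  then have "computable_rat_seq q"
    unfolding q_def by (rule rat_seq_comp[OF w(1)])
  moreover have "incseq q"
    unfolding incseq_Suc_iff q_def by (auto simp: argmax_Suc)
  moreover have "(\<lambda>s. real_of_rat (q s)) \<longlonglongrightarrow> x"
  proof (rule tendsto_sandwich)
    show "\<forall>\<^sub>F s in sequentially. real_of_rat (w (N + s)) \<le> real_of_rat (q s)"
      unfolding q_def by (auto simp: of_rat_less_eq intro!: always_eventually argmax_ge)
    show "\<forall>\<^sub>F s in sequentially. real_of_rat (q s) \<le> x"
      unfolding q_def by (intro always_eventually allI below conjunct1[OF argmax_bounds]) simp
    show "(\<lambda>s. real_of_rat (w (N + s))) \<longlonglongrightarrow> x"
      using LIMSEQ_ignore_initial_segment[OF w(2), of N] by (simp add: add.commute)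
  qed simp
  ultimately show ?thesis unfolding left_ce_def by blast
qed

lemma not_left_ce_above:
  assumes "computable_rat_seq w" "(\<lambda>s. real_of_rat (w s)) \<longlonglongrightarrow> x" "\<not> left_ce x"
  shows "\<exists>s\<ge>N. real_of_rat (w s) > x"
  using left_ce_lower_limit[OF assms(1,2), of N] assms(3) by (meson not_le)

lemma left_ceE:
  assumes "left_ce x"
  obtains q where "computable_rat_seq q" "incseq q" "(\<lambda>n. real_of_rat (q n)) \<longlonglongrightarrow> x"
    "\<And>n. real_of_rat (q n) \<le> x"
proof -
  obtain q where q: "computable_rat_seq q" "incseq q" "(\<lambda>n. real_of_rat (q n)) \<longlonglongrightarrow> x"
    using assms unfolding left_ce_def by blast
  moreover have "real_of_rat (q n) \<le> x" for n
    by (rule incseq_le[OF _ q(3)]) (use q(2) in \<open>auto simp: incseq_def of_rat_less_eq\<close>)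
  ultimately show thesis using that by blast
qed

section \<open>Closure properties of left-c.e. reals\<close>

lemma left_ce_add:
  assumes "left_ce x" "left_ce y"
  shows "left_ce (x + y)"
proof -
  obtain q where q: "computable_rat_seq q" "incseq q" "(\<lambda>n. real_of_rat (q n)) \<longlonglongrightarrow> x"
    using assms(1) unfolding left_ce_def by blast
  obtain r where r: "computable_rat_seq r" "incseq r" "(\<lambda>n. real_of_rat (r n)) \<longlonglongrightarrow> y"
    using assms(2) unfolding left_ce_def by blast
  have "computable_rat_seq (\<lambda>n. q n + r n)" by (intro comp_intros q r)
  moreover have "incseq (\<lambda>n. q n + r n)" using q r by (auto simp: incseq_def intro: add_mono)
  moreover have "(\<lambda>n. real_of_rat (q n + r n)) \<longlonglongrightarrow> x + y"
    using tendsto_add[OF q(3) r(3)] by (simp add: of_rat_add)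
  ultimately show ?thesis unfolding left_ce_def by blast
qed

lemma left_ce_scale:
  assumes "left_ce x" "c \<ge> 0"
  shows "left_ce (real_of_rat c * x)"
proof -
  obtain q where q: "computable_rat_seq q" "incseq q" "(\<lambda>n. real_of_rat (q n)) \<longlonglongrightarrow> x"
    using assms(1) unfolding left_ce_def by blast
  have "computable_rat_seq (\<lambda>n. c * q n)" by (intro comp_intros q)
  moreover have "incseq (\<lambda>n. c * q n)" using q assms by (auto simp: incseq_def intro: mult_left_mono)
  moreover have "(\<lambda>n. real_of_rat (c * q n)) \<longlonglongrightarrow> real_of_rat c * x"
    using tendsto_mult_left[OF q(3)] by (simp add: of_rat_mult)
  ultimately show ?thesis unfolding left_ce_def by blast
qed

lemma right_ce_iff: "right_ce x \<longleftrightarrow> left_ce (- x)"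
proof
  assume "right_ce x"
  then obtain q where q: "computable_rat_seq q" "decseq q" "(\<lambda>n. real_of_rat (q n)) \<longlonglongrightarrow> x"
    unfolding right_ce_def by blast
  then have "incseq (\<lambda>n. - q n)" "(\<lambda>n. real_of_rat (- q n)) \<longlonglongrightarrow> - x"
    by (auto simp: decseq_def incseq_def of_rat_minus intro: tendsto_minus)
  with rat_seq_uminus[OF q(1)] show "left_ce (- x)" unfolding left_ce_def by blast
next
  assume "left_ce (- x)"
  then obtain q where q: "computable_rat_seq q" "incseq q" "(\<lambda>n. real_of_rat (q n)) \<longlonglongrightarrow> - x"
    unfolding left_ce_def by blast
  then have "decseq (\<lambda>n. - q n)" "(\<lambda>n. real_of_rat (- q n)) \<longlonglongrightarrow> x"
    using tendsto_minus[OF q(3)] by (auto simp: decseq_def incseq_def of_rat_minus)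
  with rat_seq_uminus[OF q(1)] show "right_ce x" unfolding right_ce_def by blast
qed

section \<open>Solovay tests\<close>

text \<open>The first bit is the most significant one, so the cylinder of \<open>w\<close> starts at
  \<open>str_val w / 2 ^ length w\<close> and has length \<open>1 / 2 ^ length w\<close>. In
  \<open>str_code\<close>, by contrast, the first bit is the least significant one.\<close>

definition str_val :: "bool list \<Rightarrow> nat" where
  "str_val w = (\<Sum>i<length w. of_bool (w ! i) * 2 ^ (length w - 1 - i))"

lemma str_val_snoc: "str_val (w @ [b]) = 2 * str_val w + of_bool b"
proof -
  have "(\<Sum>i<length w. of_bool ((w @ [b]) ! i) * 2 ^ (length w - i))
      = (\<Sum>i<length w. 2 * (of_bool (w ! i) * 2 ^ (length w - 1 - i)) :: nat)"
  proof (rule sum.cong, simp)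
    fix i assume "i \<in> {..<length w}"
    then have "length w - i = Suc (length w - 1 - i)" by auto
    then show "of_bool ((w @ [b]) ! i) * 2 ^ (length w - i)
        = (2 * (of_bool (w ! i) * 2 ^ (length w - 1 - i)) :: nat)"
      using \<open>i \<in> _\<close> by (simp add: nth_append)
  qed
  then show ?thesis
    by (simp add: str_val_def sum_distrib_left del: sum_of_bool_mult_eq sum_mult_of_bool_eq)
qed

lemma str_val_Nil [simp]: "str_val [] = 0"
  by (simp add: str_val_def)

lemma str_val_inj: "length v = length w \<Longrightarrow> str_val v = str_val w \<Longrightarrow> v = w"
proof (induction v arbitrary: w rule: rev_induct)
  case (snoc b v)
  from snoc.prems(1) obtain w' b' where w: "w = w' @ [b']" by (cases w rule: rev_cases) auto
  from snoc.prems have eq: "2 * str_val v + of_bool b = 2 * str_val w' + of_bool b'"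
    by (simp add: w str_val_snoc)
  then have "b = b'" by (cases b; cases b'; simp; presburger)
  with eq snoc show ?case by (simp add: w)
qed simp

text \<open>In integers: the cylinder of an extension lies inside the cylinder of the
  prefix.\<close>

lemma str_val_append:
  "str_val u * 2 ^ length v \<le> str_val (u @ v)"
  "str_val (u @ v) + 1 \<le> (str_val u + 1) * 2 ^ length v"
proof (induction v rule: rev_induct)
  case (snoc b v)
  { case 1 show ?case using snoc(1) unfolding append_assoc[symmetric] str_val_snoc by simp }
  { case 2 show ?case using snoc(2) unfolding append_assoc[symmetric] str_val_snoc
      by (cases b) auto }
qed auto

lemma str_val_frac:
  "real (str_val (map (frac_bit x) [0..<k])) = of_int \<lfloor>frac x * 2 ^ k\<rfloor>"
proof (induction k)
  case 0
  then show ?case by (simp add: frac_lt_1 floor_eq_iff)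
next
  case (Suc k)
  define y where "y = frac x * 2 ^ k"
  have y: "frac x * 2 ^ Suc k = 2 * y" by (simp add: y_def)
  have b: "\<lfloor>2 * y\<rfloor> = 2 * \<lfloor>y\<rfloor> \<or> \<lfloor>2 * y\<rfloor> = 2 * \<lfloor>y\<rfloor> + 1" by linarith
  have "frac_bit x k = odd \<lfloor>2 * y\<rfloor>" unfolding frac_bit_def y ..
  then have "real (str_val (map (frac_bit x) [0..<Suc k]))
      = 2 * of_int \<lfloor>y\<rfloor> + of_bool (odd \<lfloor>2 * y\<rfloor>)"
    using Suc by (simp add: str_val_snoc y_def)
  also have "\<dots> = of_int \<lfloor>2 * y\<rfloor>" using b by auto
  finally show ?case by (simp only: y)
qed

lemma str_code_simps [simp]:
  "str_code [] = 1" "str_code (b # w) = 2 * str_code w + of_bool b"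
  by (simp_all add: str_code_def)

lemma str_code_bounds: "2 ^ length w \<le> str_code w" "str_code w < 2 * 2 ^ length w"
  by (induction w) auto

lemma str_code_pos: "str_code w \<ge> 1"
  by (rule order_trans[OF _ str_code_bounds(1)]) simp

lemma str_code_surj: "c \<ge> 1 \<Longrightarrow> \<exists>w. c = str_code w"
proof (induction c rule: less_induct)
  case (less c)
  show ?case
  proof (cases "c = 1")
    case True
    then show ?thesis by (intro exI[of _ "[]"]) simp
  next
    case False
    with less have "c div 2 < c" "c div 2 \<ge> 1" by auto
    from less.IH[OF this] obtain w where w: "c div 2 = str_code w" ..
    then have "c = str_code (odd c # w)"
      by (metis str_code_simps(2) add.commute mult.commute mod2_eq_if mult_div_mod_eq of_bool_def)
    then show ?thesis ..
  qed
qed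

lemma str_code_mod: "j \<le> length w \<Longrightarrow> str_code w mod 2 ^ j + 2 ^ j = str_code (take j w)"
proof (induction w arbitrary: j)
  case (Cons b w)
  show ?case
  proof (cases j)
    case (Suc i)
    have "(2 * str_code w + of_bool b) mod (2 * 2 ^ i) = 2 * (str_code w mod 2 ^ i) + of_bool b"
      using mod_mult2_eq[of "2 * str_code w + of_bool b" 2 "2 ^ i"] by (cases b) auto
    then show ?thesis using Cons.IH[of i] Cons.prems by (simp add: Suc)
  qed simp
qed simp

lemma str_code_bit: "i < length w \<Longrightarrow> odd (str_code w div 2 ^ i) = w ! i"
proof (induction w arbitrary: i)
  case (Cons b w)
  show ?case
  proof (cases i)
    case (Suc k)
    have "(2 * str_code w + of_bool b) div (2 * 2 ^ k) = str_code w div 2 ^ k"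
      by (cases b) (simp_all add: div_mult2_eq)
    then show ?thesis using Cons by (simp add: Suc)
  qed simp
qed simp

text \<open>The exponent of the leading sentinel of the code. Length, value and prefixes are
  recomputed from the number alone by bounded sums, quotients and remainders, so that
  \<open>comp_intros\<close> applies to them.\<close>

definition code_len :: "nat \<Rightarrow> nat" where
  "code_len c = (\<Sum>j<c. if 2 ^ Suc j \<le> c then 1 else 0)"

definition code_val :: "nat \<Rightarrow> nat" where
  "code_val c = (\<Sum>i<code_len c. (c div 2 ^ i) mod 2 * 2 ^ (code_len c - 1 - i))"

text \<open>The low \<open>j\<close> bits of a code are the first \<open>j\<close> letters of the
  string, and the summand \<open>2 ^ j\<close> is their new sentinel.\<close>

definition code_take :: "nat \<Rightarrow> nat \<Rightarrow> nat" where
  "code_take j c = c mod 2 ^ j + 2 ^ j"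

lemma code_len [simp]: "code_len (str_code w) = length w"
proof -
  have "j < str_code w \<and> 2 ^ Suc j \<le> str_code w \<longleftrightarrow> j < length w" for j
  proof
    assume "j < str_code w \<and> 2 ^ Suc j \<le> str_code w"
    then have "(2::nat) ^ Suc j < 2 ^ Suc (length w)"
      using str_code_bounds(2)[of w] unfolding power_Suc by linarith
    then show "j < length w" by simp
  next
    assume j: "j < length w"
    then have "(2::nat) ^ Suc j \<le> 2 ^ length w" by (intro power_increasing) auto
    moreover have "j < 2 ^ Suc j" by (rule order_less_trans[OF lessI]) (rule less_exp)
    ultimately show "j < str_code w \<and> 2 ^ Suc j \<le> str_code w"
      using str_code_bounds(1)[of w] by linarith
  qed
  then have "{j. j < str_code w \<and> 2 ^ Suc j \<le> str_code w} = {..<length w}" by blast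
  then show ?thesis unfolding code_len_def by (simp add: sum.If_cases Int_def)
qed

lemma code_val [simp]: "code_val (str_code w) = str_val w"
proof -
  have "(str_code w div 2 ^ i) mod 2 = of_bool (w ! i)" if "i < length w" for i
    by (simp add: mod_2_eq_odd str_code_bit that)
  then show ?thesis unfolding code_val_def str_val_def by simp
qed

lemma code_take [simp]: "j \<le> length w \<Longrightarrow> code_take j (str_code w) = str_code (take j w)"
  by (simp add: code_take_def str_code_mod)

lemma str_code_inject: "str_code v = str_code w \<longleftrightarrow> v = w"
  using code_len[of v] code_len[of w] code_val[of v] code_val[of w] str_val_inj[of v w] by metis

lemma computable_code_len [comp_intros]:
  assumes "computable f"
  shows "computable (\<lambda>n. code_len (f n))"
proof -
  have "computable (\<lambda>c. code_len c)" unfolding code_len_def by (intro comp_intros)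
  from computable_comp[OF this assms] show ?thesis .
qed

lemma computable_code_val [comp_intros]:
  assumes "computable f"
  shows "computable (\<lambda>n. code_val (f n))"
proof -
  have "computable (\<lambda>c. code_val c)" unfolding code_val_def by (intro comp_intros)
  from computable_comp[OF this assms] show ?thesis .
qed

lemma computable_code_take [comp_intros]:
  "computable f \<Longrightarrow> computable g \<Longrightarrow> computable (\<lambda>n. code_take (f n) (g n))"
  unfolding code_take_def by (intro comp_intros)

text \<open>The \<open>max 0\<close> allows an index to carry the empty interval from 1 to 0. A test
  can thus discard indices that fail a decidable condition and still be a sequence over all
  naturals.\<close>

definition solovay_test :: "(nat \<Rightarrow> rat) \<Rightarrow> (nat \<Rightarrow> rat) \<Rightarrow> bool" where
  "solovay_test a b \<longleftrightarrow> computable_rat_seq a \<and> computable_rat_seq b \<and>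
    (\<exists>K. \<forall>F. finite F \<longrightarrow> (\<Sum>i\<in>F. max 0 (real_of_rat (b i - a i))) \<le> K)"

definition solovay_random :: "real \<Rightarrow> bool" where
  "solovay_random x \<longleftrightarrow> (\<forall>a b. solovay_test a b \<longrightarrow>
    finite {i. real_of_rat (a i) \<le> x \<and> x \<le> real_of_rat (b i)})"

lemma solovay_testI:
  assumes "computable_rat_seq a" "computable_rat_seq b"
    and "\<And>F. finite F \<Longrightarrow> (\<Sum>i\<in>F. max 0 (real_of_rat (b i - a i))) \<le> K"
  shows "solovay_test a b"
  using assms unfolding solovay_test_def by blast

section \<open>Counting cylinders inside intervals, and Martin-Loef against Solovay
  randomness\<close>

lemma card_nat_between:
  "finite {k::nat. A \<le> real k \<and> real k + 1 \<le> B}"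
  "real (card {k::nat. A \<le> real k \<and> real k + 1 \<le> B}) \<le> max 0 (B - A)"
proof -
  define S where "S = {k::nat. A \<le> real k \<and> real k + 1 \<le> B}"
  have sub: "int ` S \<subseteq> {\<lceil>A\<rceil>..<\<lfloor>B\<rfloor>}"
  proof
    fix j assume "j \<in> int ` S"
    then obtain k where "j = int k" "A \<le> real k" "real k + 1 \<le> B" by (auto simp: S_def)
    then show "j \<in> {\<lceil>A\<rceil>..<\<lfloor>B\<rfloor>}" by (auto simp: ceiling_le_iff) linarith
  qed
  then have "finite (int ` S)" by (rule finite_subset) simp
  then show fin: "finite {k::nat. A \<le> real k \<and> real k + 1 \<le> B}"
    unfolding S_def[symmetric] by (rule finite_imageD) simp
  have "card S = card (int ` S)" by (rule card_image[symmetric]) simp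
  also have "\<dots> \<le> card {\<lceil>A\<rceil>..<\<lfloor>B\<rfloor>}" by (rule card_mono[OF _ sub]) simp
  also have "\<dots> = nat (\<lfloor>B\<rfloor> - \<lceil>A\<rceil>)" by simp
  finally have "real (card S) \<le> real (nat (\<lfloor>B\<rfloor> - \<lceil>A\<rceil>))" by simp
  also have "\<dots> \<le> max 0 (B - A)" by (cases "\<lceil>A\<rceil> \<le> \<lfloor>B\<rfloor>") (auto simp: max_def, linarith+)
  finally show "real (card {k::nat. A \<le> real k \<and> real k + 1 \<le> B}) \<le> max 0 (B - A)"
    unfolding S_def .
qed

text \<open>The closed cylinder of \<open>w\<close> lies in the closed interval. The products with
  \<open>1 / 2 ^ length w\<close> have the shape that the computability rules for rational sequences
  recognise.\<close>

definition str_in :: "bool list \<Rightarrow> rat \<Rightarrow> rat \<Rightarrow> bool" where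
  "str_in w a b \<longleftrightarrow> a \<le> of_nat (str_val w) * (1 / 2 ^ length w) \<and>
    of_nat (Suc (str_val w)) * (1 / 2 ^ length w) \<le> b"

lemma str_in_append:
  assumes "str_in u a b"
  shows "str_in (u @ v) a b"
proof -
  have "of_nat (str_val u * 2 ^ length v) \<le> (of_nat (str_val (u @ v)) :: rat)"
    using str_val_append(1) by (simp only: of_nat_le_iff)
  then have 1: "of_nat (str_val u) * (1 / 2 ^ length u)
      \<le> (of_nat (str_val (u @ v)) * (1 / 2 ^ length (u @ v)) :: rat)"
    by (simp add: power_add divide_simps mult.commute mult.left_commute)
  have "of_nat (Suc (str_val (u @ v))) \<le> (of_nat (Suc (str_val u) * 2 ^ length v) :: rat)"
    using str_val_append(2)[of u v] unfolding of_nat_le_iff by simp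
  then have "of_nat (Suc (str_val (u @ v))) * (1 / 2 ^ length (u @ v))
      \<le> (of_nat (Suc (str_val u)) * (1 / 2 ^ length u) :: rat)"
    unfolding of_nat_mult by (simp add: power_add divide_simps mult.commute mult.left_commute del: of_nat_Suc)
  with 1 show ?thesis using assms unfolding str_in_def by linarith
qed

text \<open>After scaling by \<open>2 ^ L\<close> the cylinders of length \<open>L\<close> are unit
  cells with integer endpoints, and no more of them fit into an interval than its length.\<close>

lemma card_str_in:
  "real (card {w. length w = L \<and> str_in w a b}) \<le> 2 ^ L * max 0 (real_of_rat (b - a))"
proof -
  let ?W = "{w. length w = L \<and> str_in w a b}"
  let ?S = "{k::nat. 2 ^ L * real_of_rat a \<le> real k \<and> real k + 1 \<le> 2 ^ L * real_of_rat b}"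
  have "inj_on str_val ?W" by (rule inj_onI) (auto intro: str_val_inj)
  moreover have "str_val ` ?W \<subseteq> ?S"
  proof
    fix k assume "k \<in> str_val ` ?W"
    then obtain w where w: "k = str_val w" "length w = L" "str_in w a b" by auto
    have "real_of_rat a \<le> real_of_rat (of_nat k * (1 / 2 ^ L))"
      "real_of_rat (of_nat (Suc k) * (1 / 2 ^ L)) \<le> real_of_rat b"
      using w unfolding str_in_def of_rat_less_eq by auto
    then show "k \<in> ?S"
      by (simp add: of_rat_mult of_rat_divide of_rat_power of_rat_add field_simps)
  qed
  ultimately have "card ?W \<le> card ?S" using card_nat_between(1) by (rule card_inj_on_le)
  then have "real (card ?W) \<le> real (card ?S)" by simp
  also have "\<dots> \<le> max 0 (2 ^ L * real_of_rat b - 2 ^ L * real_of_rat a)"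
    by (rule card_nat_between)
  also have "\<dots> = 2 ^ L * max 0 (real_of_rat (b - a))"
    by (simp add: of_rat_diff max_mult_distrib_left right_diff_distrib)
  finally show ?thesis .
qed

lemma frac_in_cylinder:
  fixes x k defines "w \<equiv> map (frac_bit x) [0..<k]"
  shows "real (str_val w) / 2 ^ k \<le> frac x" "frac x < (real (str_val w) + 1) / 2 ^ k"
proof -
  have "real (str_val w) = of_int \<lfloor>frac x * 2 ^ k\<rfloor>" unfolding w_def by (rule str_val_frac)
  then have "real (str_val w) \<le> frac x * 2 ^ k" "frac x * 2 ^ k < real (str_val w) + 1"
    by linarith+
  then show "real (str_val w) / 2 ^ k \<le> frac x" "frac x < (real (str_val w) + 1) / 2 ^ k"
    by (simp_all add: field_simps)
qed

lemma eventually_str_in_frac: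
  assumes "real_of_rat a < frac x" "frac x < real_of_rat b"
  shows "\<forall>\<^sub>F k in sequentially. str_in (map (frac_bit x) [0..<k]) a b"
proof -
  define e where "e = min (frac x - real_of_rat a) (real_of_rat b - frac x)"
  have "e > 0" using assms by (simp add: e_def)
  have "(\<lambda>k. (1 / 2 :: real) ^ k) \<longlonglongrightarrow> 0" by (rule LIMSEQ_power_zero) simp
  with \<open>e > 0\<close> have "\<forall>\<^sub>F k in sequentially. (1 / 2 :: real) ^ k < e" by (metis order_tendstoD(2))
  then show ?thesis
  proof eventually_elim
    case (elim k)
    let ?w = "map (frac_bit x) [0..<k]"
    have "real_of_rat a \<le> real (str_val ?w) / 2 ^ k" "(real (str_val ?w) + 1) / 2 ^ k \<le> real_of_rat b"
      using frac_in_cylinder[of x k] elim unfolding e_def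
      by (auto simp: power_one_over add_divide_distrib)
    then have "real_of_rat a \<le> real_of_rat (of_nat (str_val ?w) * (1 / 2 ^ k))"
      "real_of_rat (of_nat (Suc (str_val ?w)) * (1 / 2 ^ k)) \<le> real_of_rat b"
      by (simp_all add: of_rat_mult of_rat_divide of_rat_power of_rat_add add.commute)
    then show ?case unfolding str_in_def of_rat_less_eq by simp
  qed
qed

text \<open>The level \<open>n\<close> of the Martin-Loef test consists of the strings whose cylinder lies in
  \<open>K * 2 ^ n\<close> of the first intervals of the Solovay test.\<close>

lemma mloef_random_imp_solovay:
  assumes "mloef_random_real x"
  shows "solovay_random x"
  unfolding solovay_random_def
proof (intro allI impI)
  fix a b assume "solovay_test a b"
  then obtain K0 where ab: "computable_rat_seq a" "computable_rat_seq b"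
    and K0: "\<And>F. finite F \<Longrightarrow> (\<Sum>i\<in>F. max 0 (real_of_rat (b i - a i))) \<le> K0"
    unfolding solovay_test_def by blast
  define m :: rat where "m = of_int \<lfloor>x\<rfloor>"
  \<comment> \<open>The shift by \<open>m\<close> passes to the fractional part. The widening puts
    it strictly inside, since at an endpoint the cylinders around it might never fit into the
    interval.\<close>
  define a' where "a' i = a i - m - 1 / 2 ^ i" for i
  define b' where "b' i = b i - m + 1 / 2 ^ i" for i
  \<comment> \<open>The 4 pays for widening every interval by \<open>1 / 2 ^ i\<close> on both
    sides. The final 1 makes \<open>K\<close> positive, so that it cancels in the measure
    estimate.\<close>
  define K where "K = nat \<lceil>K0 + 4\<rceil> + 1"
  have K: "(\<Sum>i<L. max 0 (real_of_rat (b' i - a' i))) \<le> real K" for L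
  proof -
    have "(\<Sum>i<L. (1/2::real) ^ i) = 2 * (1 - (1/2) ^ L)" by (simp add: sum_gp_strict)
    then have g: "(\<Sum>i<L. (1/2::real) ^ i) \<le> 2" by simp
    have "max 0 (real_of_rat (b' i - a' i)) \<le> max 0 (real_of_rat (b i - a i)) + 2 * (1/2) ^ i" for i
      unfolding a'_def b'_def
      by (auto simp: of_rat_diff of_rat_add of_rat_divide of_rat_power power_one_over)
    then have "(\<Sum>i<L. max 0 (real_of_rat (b' i - a' i)))
        \<le> (\<Sum>i<L. max 0 (real_of_rat (b i - a i)) + 2 * (1/2) ^ i)" by (intro sum_mono)
    also have "\<dots> = (\<Sum>i<L. max 0 (real_of_rat (b i - a i))) + 2 * (\<Sum>i<L. (1/2) ^ i)"
      by (simp add: sum.distrib sum_distrib_left)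
    also have "\<dots> \<le> K0 + 4" using K0[of "{..<L}"] g by simp
    also have "\<dots> \<le> real K" unfolding K_def by linarith
    finally show ?thesis .
  qed
  \<comment> \<open>Only the first \<open>length w\<close> intervals are examined. This keeps
    membership in \<open>U n\<close> decidable, and the count still grows along extensions.\<close>
  define N where "N w = (\<Sum>i<length w. if str_in w (a' i) (b' i) then 1 else 0 :: nat)" for w
  define U where "U n = {w. K * 2 ^ n \<le> N w}" for n
  have N_card: "N w = card {i. i < length w \<and> str_in w (a' i) (b' i)}" for w
    unfolding N_def by (simp add: sum.If_cases Int_def)
  have N_append: "N u \<le> N (u @ v)" for u v
    unfolding N_card by (intro card_mono) (auto intro: str_in_append)
  have "mloef_test U"
    unfolding mloef_test_def
  proof (intro conjI allI)
    define T where "T n c \<longleftrightarrow> 1 \<le> c \<and> K * 2 ^ n \<le> (\<Sum>i<code_len c.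
      if a' i \<le> of_nat (code_val c) * (1 / 2 ^ code_len c) \<and>
        of_nat (Suc (code_val c)) * (1 / 2 ^ code_len c) \<le> b' i then 1 else 0)" for n c
    have a': "computable_rat_seq a'" and b': "computable_rat_seq b'"
      unfolding a'_def b'_def by (intro comp_intros ab)+
    then have "decidable (\<lambda>p. T (p1 p) (p2 p))"
      unfolding T_def by (intro comp_intros rat_seq_comp[OF a'] rat_seq_comp[OF b'])
    moreover have T: "T n (str_code w) \<longleftrightarrow> w \<in> U n" for n w
      unfolding T_def U_def N_def str_in_def using str_code_pos[of w] by simp
    have "{prod_encode (n, str_code w) |n w. w \<in> U n} = {p. T (p1 p) (p2 p)}"
    proof (intro set_eqI iffI)
      fix p assume "p \<in> {p. T (p1 p) (p2 p)}"
      then have p: "T (p1 p) (p2 p)" by simp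
      then obtain w where w: "p2 p = str_code w" using str_code_surj T_def by blast
      then have "p = prod_encode (p1 p, str_code w)" by (metis prod.collapse prod_decode_inverse)
      with p w T show "p \<in> {prod_encode (n, str_code w) |n w. w \<in> U n}" by auto
    qed (auto simp: T)
    ultimately show "ce_set {prod_encode (n, str_code w) |n w. w \<in> U n}"
      using ce_set_decidable by simp
  next
    fix n
    show "measure_le (U n) ((1/2) ^ n)"
      unfolding measure_le_def
    proof
      fix L
      let ?S = "{w. length w = L \<and> (\<exists>u\<in>U n. take (length u) w = u)}"
      have "finite {w :: bool list. length w = L}"
        using finite_lists_length_eq[of "UNIV :: bool set" L] by simp
      then have fin: "finite ?S" by (rule rev_finite_subset) auto
      have "K * 2 ^ n \<le> N w" if w: "w \<in> ?S" for w
      proof -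
        from w obtain u where "u \<in> U n" "take (length u) w = u" by blast
        moreover from this(2) have "w = u @ drop (length u) w" by (metis append_take_drop_id)
        ultimately show ?thesis using N_append[of u "drop (length u) w"] by (simp add: U_def)
      qed
      \<comment> \<open>Double counting of the pairs of a string and an interval that contains its
        cylinder: each string occurs in at least \<open>K * 2 ^ n\<close> pairs, each interval in at
        most \<open>2 ^ L\<close> times its length.\<close>
      then have "card ?S * (K * 2 ^ n) \<le> (\<Sum>w\<in>?S. N w)"
        using sum_bounded_below[of ?S "K * 2 ^ n" N] by simp
      also have "\<dots> = (\<Sum>w\<in>?S. \<Sum>i<L. if str_in w (a' i) (b' i) then 1 else 0)"
        by (intro sum.cong) (auto simp: N_def)
      also have "\<dots> = (\<Sum>i<L. \<Sum>w\<in>?S. if str_in w (a' i) (b' i) then 1 else 0)"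
        by (rule sum.swap)
      also have "\<dots> \<le> (\<Sum>i<L. card {w. length w = L \<and> str_in w (a' i) (b' i)})"
      proof (rule sum_mono)
        fix i
        have "(\<Sum>w\<in>?S. if str_in w (a' i) (b' i) then 1 else 0) = card {w\<in>?S. str_in w (a' i) (b' i)}"
          using fin by (simp add: sum.If_cases Int_def)
        also have "\<dots> \<le> card {w. length w = L \<and> str_in w (a' i) (b' i)}"
        proof (rule card_mono)
          show "finite {w. length w = L \<and> str_in w (a' i) (b' i)}"
            by (rule rev_finite_subset[OF \<open>finite {w. length w = L}\<close>]) auto
        qed auto
        finally show "(\<Sum>w\<in>?S. if str_in w (a' i) (b' i) then 1 else 0)
          \<le> card {w. length w = L \<and> str_in w (a' i) (b' i)}" .
      qed
      finally have "real (card ?S * (K * 2 ^ n))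
          \<le> real (\<Sum>i<L. card {w. length w = L \<and> str_in w (a' i) (b' i)})"
        by (simp only: of_nat_le_iff)
      also have "\<dots> \<le> (\<Sum>i<L. 2 ^ L * max 0 (real_of_rat (b' i - a' i)))"
        unfolding of_nat_sum by (intro sum_mono card_str_in)
      also have "\<dots> \<le> 2 ^ L * real K"
        unfolding sum_distrib_left[symmetric] by (intro mult_left_mono K) simp
      finally have "real K * (real (card ?S) * 2 ^ n) \<le> real K * 2 ^ L"
        by (simp add: mult_ac)
      then have "real (card ?S) * 2 ^ n \<le> 2 ^ L" by (rule mult_left_le_imp_le) (simp add: K_def)
      then show "real (card ?S) \<le> (1/2) ^ n * 2 ^ L"
        by (simp add: power_one_over divide_simps mult.commute)
    qed
  qed
  then obtain n where n: "\<And>k. map (frac_bit x) [0..<k] \<notin> U n"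
    using assms unfolding mloef_random_real_def mloef_random_seq_def by blast
  show "finite {i. real_of_rat (a i) \<le> x \<and> x \<le> real_of_rat (b i)}"
  proof (rule ccontr)
    assume "infinite {i. real_of_rat (a i) \<le> x \<and> x \<le> real_of_rat (b i)}"
    then obtain F where F: "F \<subseteq> {i. real_of_rat (a i) \<le> x \<and> x \<le> real_of_rat (b i)}"
      "finite F" "card F = K * 2 ^ n"
      using infinite_arbitrarily_large[of _ "K * 2 ^ n"] by blast
    have "\<forall>\<^sub>F k in sequentially. \<forall>i\<in>F. str_in (map (frac_bit x) [0..<k]) (a' i) (b' i)"
    proof (rule eventually_ball_finite[OF F(2)], rule ballI)
      fix i assume "i \<in> F"
      then have "real_of_rat (a i) \<le> x" "x \<le> real_of_rat (b i)" using F by auto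
      moreover have "0 < 1 / (2::real) ^ i" by simp
      moreover have "real_of_rat (a' i) = real_of_rat (a i) - of_int \<lfloor>x\<rfloor> - 1 / 2 ^ i"
        "real_of_rat (b' i) = real_of_rat (b i) - of_int \<lfloor>x\<rfloor> + 1 / 2 ^ i"
        by (simp_all add: a'_def b'_def m_def of_rat_diff of_rat_add of_rat_divide of_rat_power)
      ultimately have "real_of_rat (a' i) < frac x" "frac x < real_of_rat (b' i)"
        unfolding frac_def by linarith+
      then show "\<forall>\<^sub>F k in sequentially. str_in (map (frac_bit x) [0..<k]) (a' i) (b' i)"
        by (rule eventually_str_in_frac)
    qed
    moreover have "\<forall>\<^sub>F k in sequentially. \<forall>i\<in>F. i < k"
      by (intro eventually_ball_finite[OF F(2)] ballI eventually_gt_at_top)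
    ultimately have "\<forall>\<^sub>F k in sequentially. map (frac_bit x) [0..<k] \<in> U n"
    proof eventually_elim
      case (elim k)
      then have "F \<subseteq> {i. i < k \<and> str_in (map (frac_bit x) [0..<k]) (a' i) (b' i)}" by blast
      then have "card F \<le> card {i. i < k \<and> str_in (map (frac_bit x) [0..<k]) (a' i) (b' i)}"
        by (intro card_mono) auto
      then show ?case by (simp add: U_def N_card F)
    qed
    with n show False by simp
  qed
qed

text \<open>All strings of \<open>W\<close> are extended to one common length \<open>L\<close>.
  Prefix-freeness makes the sets of extensions disjoint, and every extension still has a prefix in
  \<open>U\<close>, so \<open>measure_le\<close> at length \<open>L\<close> bounds their
  number.\<close>

lemma prefix_free_measure:
  assumes "measure_le U r" "finite W"
    and pf: "\<And>v w. v \<in> W \<Longrightarrow> w \<in> W \<Longrightarrow> take (length v) w = v \<Longrightarrow> v = w"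
    and U: "\<And>w. w \<in> W \<Longrightarrow> \<exists>u\<in>U. take (length u) w = u"
  shows "(\<Sum>w\<in>W. (1/2) ^ length w) \<le> r"
proof -
  define L where "L = Max (insert 0 (length ` W))"
  have L: "length w \<le> L" if "w \<in> W" for w
    unfolding L_def using that \<open>finite W\<close> by (intro Max_ge) auto
  define E where "E w = (\<lambda>v. w @ v) ` {v :: bool list. length v = L - length w}" for w
  have lists: "finite {v :: bool list. length v = l}" "card {v :: bool list. length v = l} = 2 ^ l" for l
    using finite_lists_length_eq[of "UNIV :: bool set" l] card_lists_length_eq[of "UNIV :: bool set" l]
    by simp_all
  have "card (E w) = 2 ^ (L - length w)" for w
    unfolding E_def by (subst card_image) (auto simp: inj_on_def lists)
  moreover have "E v \<inter> E w = {}" if "v \<in> W" "w \<in> W" "v \<noteq> w" for v w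
  proof (rule ccontr)
    assume "E v \<inter> E w \<noteq> {}"
    then obtain s t where st: "v @ s = w @ t" by (auto simp: E_def)
    have "take (length v) w = v \<or> take (length w) v = w"
      using st by (metis append_eq_conv_conj nle_le take_all take_append append_Nil2 diff_is_0_eq take_0)
    then show False using pf[of v w] pf[of w v] that by auto
  qed
  ultimately have "card (\<Union>w\<in>W. E w) = (\<Sum>w\<in>W. 2 ^ (L - length w))"
    using card_UN_disjoint[of W E] \<open>finite W\<close> lists by (auto simp: E_def)
  moreover have "(\<Union>w\<in>W. E w) \<subseteq> {w. length w = L \<and> (\<exists>u\<in>U. take (length u) w = u)}"
  proof
    fix z assume "z \<in> (\<Union>w\<in>W. E w)"
    then obtain w v where w: "w \<in> W" "z = w @ v" "length v = L - length w" by (auto simp: E_def)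
    from U[OF w(1)] obtain u where u: "u \<in> U" "take (length u) w = u" by blast
    then have "take (length u) z = u"
      unfolding w(2) by (metis append_take_drop_id append.assoc append_eq_conv_conj)
    moreover have "length z = L" using w(2,3) L[OF w(1)] by simp
    ultimately show "z \<in> {w. length w = L \<and> (\<exists>u\<in>U. take (length u) w = u)}"
      using u(1) by blast
  qed
  then have "card (\<Union>w\<in>W. E w) \<le> card {w. length w = L \<and> (\<exists>u\<in>U. take (length u) w = u)}"
    by (intro card_mono) (auto intro: finite_subset[OF _ lists(1)[of L]])
  ultimately have "real (\<Sum>w\<in>W. 2 ^ (L - length w))
      \<le> real (card {w. length w = L \<and> (\<exists>u\<in>U. take (length u) w = u)})"
    by (simp only: of_nat_le_iff)
  also have "\<dots> \<le> r * 2 ^ L" using assms(1) unfolding measure_le_def by blast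
  finally have "(\<Sum>w\<in>W. 2 ^ (L - length w) :: real) \<le> r * 2 ^ L" by simp
  moreover have "(2::real) ^ (L - length w) = (1/2) ^ length w * 2 ^ L" if "w \<in> W" for w
    using L[OF that] by (simp add: power_diff power_one_over)
  ultimately have "(\<Sum>w\<in>W. (1/2) ^ length w) * 2 ^ L \<le> r * 2 ^ L"
    by (simp add: sum_distrib_right)
  then show ?thesis by simp
qed

text \<open>A string is put into the Solovay test when it is minimal among the strings that have a prefix
  enumerated into the level \<open>n\<close> by the stage given by their length.\<close>

lemma solovay_random_imp_mloef:
  assumes "solovay_random x"
  shows "mloef_random_real x"
  unfolding mloef_random_real_def mloef_random_seq_def
proof (intro allI impI)
  fix U assume U: "mloef_test U"
  let ?A = "{prod_encode (n, str_code w) |n w. w \<in> U n}"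
  have "ce_set ?A" using U by (simp add: mloef_test_def)
  then obtain P where P: "decidable (\<lambda>p. P (p1 p) (p2 p))"
    "\<And>c. c \<in> ?A \<longleftrightarrow> (\<exists>s. \<forall>t\<ge>s. P c t)" "\<And>c t. P c t \<Longrightarrow> c \<in> ?A"
    by (rule ce_set_decidable_stages) blast
  define R where "R n c \<longleftrightarrow> (\<exists>j<Suc (code_len c). P (prod_encode (n, code_take j c)) (code_len c))"
    for n c
  \<comment> \<open>Using the length of the string as the stage makes the choice decidable.
    Minimality makes the chosen strings of one level prefix-free, so their cylinders have total
    length at most \<open>(1/2) ^ n\<close>.\<close>
  define E where "E n c \<longleftrightarrow> R n c \<and> \<not> (\<exists>j<code_len c. R n (code_take j c))" for n c
  have R: "decidable (\<lambda>p. R (p1 p) (p2 p))"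
    unfolding R_def by (intro decidable2[OF P(1)] comp_intros)
  have E: "decidable (\<lambda>p. E (p1 p) (p2 p))"
    unfolding E_def by (intro decidable2[OF R] comp_intros)
  have R_str: "R n (str_code w) \<longleftrightarrow>
    (\<exists>j\<le>length w. P (prod_encode (n, str_code (take j w))) (length w))" for n w
    unfolding R_def by (auto simp: less_Suc_eq_le)
  have E_str: "E n (str_code w) \<longleftrightarrow>
    R n (str_code w) \<and> (\<forall>j<length w. \<not> R n (str_code (take j w)))" for n w
    unfolding E_def by auto
  define m :: rat where "m = of_int \<lfloor>x\<rfloor>"
  define V where "V p \<longleftrightarrow> 1 \<le> p2 p \<and> E (p1 p) (p2 p)" for p
  define a where "a p = (if V p then m + of_nat (code_val (p2 p)) * (1 / 2 ^ code_len (p2 p)) else 1)" for p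
  define b where "b p = (if V p then m + of_nat (Suc (code_val (p2 p))) * (1 / 2 ^ code_len (p2 p)) else 0)" for p
  have V: "decidable V" unfolding V_def by (intro E comp_intros)
  have len: "max 0 (real_of_rat (b p - a p)) = (if V p then (1/2) ^ code_len (p2 p) else 0)" for p
  proof -
    have "b p - a p = (if V p then 1 / 2 ^ code_len (p2 p) else - 1)"
      unfolding a_def b_def by (simp add: add_divide_distrib)
    then show ?thesis by (simp add: of_rat_divide of_rat_power power_one_over)
  qed
  have "solovay_test a b"
  proof (rule solovay_testI)
    show "computable_rat_seq a" "computable_rat_seq b"
      unfolding a_def b_def by (intro comp_intros V)+
    fix F :: "nat set" assume "finite F"
    define I where "I = p1 ` F"
    define W where "W n = {w. E n (str_code w) \<and> prod_encode (n, str_code w) \<in> F}" for n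
    have fin: "finite I" using \<open>finite F\<close> by (simp add: I_def)
    have inj_code: "inj (\<lambda>w. prod_encode (n, str_code w))" for n
      by (rule injI) (simp add: str_code_inject)
    have finW: "finite (W n)" for n
      using finite_vimageI[OF \<open>finite F\<close> inj_code]
      unfolding W_def vimage_def by (rule rev_finite_subset) auto
    let ?f = "\<lambda>(n, w). prod_encode (n, str_code w)"
    have inj: "inj_on ?f X" for X by (auto simp: inj_on_def str_code_inject)
    have "{p\<in>F. V p} = ?f ` (SIGMA n:I. W n)"
    proof (intro set_eqI iffI)
      fix p assume p: "p \<in> {p\<in>F. V p}"
      then obtain w where w: "p2 p = str_code w" using str_code_surj V_def by blast
      then have "p = ?f (p1 p, w)" by (metis prod.collapse prod_decode_inverse case_prod_conv)
      moreover have "(p1 p, w) \<in> (SIGMA n:I. W n)"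
        using p w calculation unfolding I_def W_def V_def by auto
      ultimately show "p \<in> ?f ` (SIGMA n:I. W n)" by (rule image_eqI)
    qed (auto simp: W_def V_def str_code_pos[simplified])
    then have "(\<Sum>p\<in>F. max 0 (real_of_rat (b p - a p)))
        = (\<Sum>p\<in>?f ` (SIGMA n:I. W n). (1/2) ^ code_len (p2 p))"
      unfolding len using \<open>finite F\<close> by (simp add: sum.If_cases Int_def)
    also have "\<dots> = (\<Sum>(n, w)\<in>(SIGMA n:I. W n). (1/2) ^ length w)"
      by (subst sum.reindex[OF inj]) (auto simp: o_def case_prod_beta intro: sum.cong)
    also have "\<dots> = (\<Sum>n\<in>I. \<Sum>w\<in>W n. (1/2) ^ length w)"
      using fin finW by (simp add: sum.Sigma)
    also have "\<dots> \<le> (\<Sum>n\<in>I. (1/2) ^ n)"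
    proof (rule sum_mono, rule prefix_free_measure[OF _ finW])
      fix n
      show "measure_le (U n) ((1/2) ^ n)" using U by (simp add: mloef_test_def)
      show "v = w" if "v \<in> W n" "w \<in> W n" "take (length v) w = v" for v w
      proof (rule ccontr)
        assume "v \<noteq> w"
        then have "length v < length w" using that(3) by (metis not_le take_all)
        with that show False unfolding W_def E_str by auto
      qed
      show "\<exists>u\<in>U n. take (length u) w = u" if "w \<in> W n" for w
      proof -
        from that obtain j where "j \<le> length w" "P (prod_encode (n, str_code (take j w))) (length w)"
          unfolding W_def E_str R_str by blast
        with P(3) have "prod_encode (n, str_code (take j w)) \<in> ?A" by blast
        then have "take j w \<in> U n" by (auto simp: str_code_inject)
        with \<open>j \<le> length w\<close> show ?thesis by (intro bexI[of _ "take j w"]) auto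
      qed
    qed
    also have "\<dots> \<le> (\<Sum>n. (1/2) ^ n)" using fin by (intro sum_le_suminf) auto
    also have "\<dots> = 2" by (simp add: suminf_geometric)
    finally show "(\<Sum>p\<in>F. max 0 (real_of_rat (b p - a p))) \<le> 2" .
  qed
  then have fin: "finite {p. real_of_rat (a p) \<le> x \<and> x \<le> real_of_rat (b p)}"
    using assms unfolding solovay_random_def by blast
  show "\<exists>n. \<forall>k. map (frac_bit x) [0..<k] \<notin> U n"
  proof (rule ccontr)
    assume neg: "\<nexists>n. \<forall>k. map (frac_bit x) [0..<k] \<notin> U n"
    have "\<exists>p. p1 p = n \<and> real_of_rat (a p) \<le> x \<and> x \<le> real_of_rat (b p)" for n
    proof -
      define X where "X k = map (frac_bit x) [0..<k]" for k
      have take_X: "take j (X k) = X j" if "j \<le> k" for j k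
        using that by (simp add: X_def take_map)
      obtain j where "X j \<in> U n" using neg unfolding X_def by blast
      then obtain s where s: "\<And>t. t \<ge> s \<Longrightarrow> P (prod_encode (n, str_code (X j))) t"
        using P(2) by blast
      \<comment> \<open>The length doubles as the stage: the prefix must contain \<open>X j\<close>
        and be long enough for the enumeration of \<open>X j\<close> to have settled.\<close>
      have "R n (str_code (X (max s j)))"
        unfolding R_str using s[of "max s j"] take_X[of j "max s j"]
        by (intro exI[of _ j]) (simp add: X_def)
      define k where "k = (LEAST k. R n (str_code (X k)))"
      have k: "R n (str_code (X k))" unfolding k_def by (rule LeastI) fact
      have "\<not> R n (str_code (X i))" if "i < k" for i
        using not_less_Least that unfolding k_def .
      then have "E n (str_code (X k))"
        unfolding E_str using k take_X by (simp add: X_def)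
      then have V: "V (prod_encode (n, str_code (X k)))"
        by (simp add: V_def str_code_pos[simplified])
      have X: "real (str_val (X k)) / 2 ^ k \<le> frac x" "frac x < (real (str_val (X k)) + 1) / 2 ^ k"
        unfolding X_def by (rule frac_in_cylinder)+
      have [simp]: "length (X k) = k" by (simp add: X_def)
      show ?thesis
        using X V
        by (intro exI[of _ "prod_encode (n, str_code (X k))"])
          (auto simp: a_def b_def m_def frac_def of_rat_add of_rat_mult of_rat_divide of_rat_power
            add_divide_distrib algebra_simps)
    qed
    then have "p1 ` {p. real_of_rat (a p) \<le> x \<and> x \<le> real_of_rat (b p)} = UNIV"
      by (auto simp: image_iff) metis
    with finite_imageI[OF fin, of p1] show False by simp
  qed
qed

lemma mloef_random_real_iff: "mloef_random_real x \<longleftrightarrow> solovay_random x"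
  using mloef_random_imp_solovay solovay_random_imp_mloef by blast

section \<open>Randomness of sums and differences\<close>

lemma solovay_random_scale:
  assumes x: "solovay_random x" and c: "c \<noteq> 0"
  shows "solovay_random (real_of_rat c * x)"
  unfolding solovay_random_def
proof (intro allI impI)
  fix a b assume "solovay_test a b"
  then obtain K where ab: "computable_rat_seq a" "computable_rat_seq b"
    and K: "\<And>F. finite F \<Longrightarrow> (\<Sum>i\<in>F. max 0 (real_of_rat (b i - a i))) \<le> K"
    unfolding solovay_test_def by blast
  define a' where "a' = (\<lambda>i. inverse c * (if c > 0 then a i else b i))"
  define b' where "b' = (\<lambda>i. inverse c * (if c > 0 then b i else a i))"
  have len: "max 0 (real_of_rat (b' i - a' i)) = \<bar>real_of_rat (inverse c)\<bar> * max 0 (real_of_rat (b i - a i))"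
    for i
  proof -
    have "b' i - a' i = \<bar>inverse c\<bar> * (b i - a i)"
      using c by (auto simp: a'_def b'_def algebra_simps abs_if)
    then have "real_of_rat (b' i - a' i) = \<bar>real_of_rat (inverse c)\<bar> * real_of_rat (b i - a i)"
      by (simp only: of_rat_mult abs_of_rat)
    then show ?thesis by (simp add: max_mult_distrib_left)
  qed
  have "solovay_test a' b'"
  proof (rule solovay_testI)
    show "computable_rat_seq a'" "computable_rat_seq b'"
      unfolding a'_def b'_def by (intro comp_intros decidable_const ab)+
    show "(\<Sum>i\<in>F. max 0 (real_of_rat (b' i - a' i))) \<le> \<bar>real_of_rat (inverse c)\<bar> * K"
      if "finite F" for F
      unfolding len sum_distrib_left[symmetric] by (intro mult_left_mono K that) simp
  qed
  then have "finite {i. real_of_rat (a' i) \<le> x \<and> x \<le> real_of_rat (b' i)}"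
    using x unfolding solovay_random_def by blast
  moreover have "{i. real_of_rat (a i) \<le> real_of_rat c * x \<and> real_of_rat c * x \<le> real_of_rat (b i)}
      \<subseteq> {i. real_of_rat (a' i) \<le> x \<and> x \<le> real_of_rat (b' i)}"
  proof (cases "c > 0")
    case True
    then have "real_of_rat c > 0" by simp
    with True show ?thesis
      by (auto simp: a'_def b'_def of_rat_mult of_rat_inverse of_rat_divide field_simps)
  next
    case False
    with c have "real_of_rat c < 0" by simp
    with False show ?thesis
      by (auto simp: a'_def b'_def of_rat_mult of_rat_inverse of_rat_divide field_simps)
  qed
  ultimately show "finite {i. real_of_rat (a i) \<le> real_of_rat c * x \<and> real_of_rat c * x \<le> real_of_rat (b i)}"
    by (rule finite_subset[rotated])
qed

lemma solovay_random_minus: "solovay_random x \<Longrightarrow> solovay_random (- x)"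
  using solovay_random_scale[of x "- 1"] by (simp add: of_rat_minus)

text \<open>The degenerate interval at 0 can be repeated forever at no cost in length.\<close>

lemma not_solovay_random_0: "\<not> solovay_random 0"
proof
  assume "solovay_random 0"
  moreover have "solovay_test (\<lambda>_. 0) (\<lambda>_. 0)"
    by (rule solovay_testI[where K = 0]) (auto intro: comp_intros)
  ultimately have "finite {i::nat. True}" unfolding solovay_random_def by force
  then show False by simp
qed

text \<open>When the approximation of \<open>y + z\<close> enters an interval, the remaining distance of the
  approximation of \<open>z\<close> is at most the length of that interval.\<close>

lemma solovay_random_add:
  assumes y: "left_ce y" and z: "left_ce z" "solovay_random z"
  shows "solovay_random (y + z)"
  unfolding solovay_random_def
proof (intro allI impI)
  fix a b assume "solovay_test a b"
  then obtain K where ab: "computable_rat_seq a" "computable_rat_seq b"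
    and K: "\<And>F. finite F \<Longrightarrow> (\<Sum>i\<in>F. max 0 (real_of_rat (b i - a i))) \<le> K"
    unfolding solovay_test_def by blast
  obtain q where q: "computable_rat_seq q" "(\<lambda>n. real_of_rat (q n)) \<longlonglongrightarrow> y"
    "\<And>n. real_of_rat (q n) \<le> y" using left_ceE[OF y] by metis
  obtain r where r: "computable_rat_seq r" "(\<lambda>n. real_of_rat (r n)) \<longlonglongrightarrow> z"
    "\<And>n. real_of_rat (r n) \<le> z" using left_ceE[OF z(1)] by metis
  \<comment> \<open>The left end is lowered so that the approximations reach it even if
    \<open>y + z\<close> equals \<open>a i\<close>. The lowering adds only a convergent geometric
    sum to the total length.\<close>
  define l where "l i = a i - 1 / 2 ^ i" for i
  \<comment> \<open>Asking for the first such stage leaves at most one new interval for each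
    \<open>i\<close>.\<close>
  define Q where "Q i s \<longleftrightarrow> a i \<le> b i \<and> l i \<le> q s + r s \<and> \<not> (\<exists>s'<s. l i \<le> q s' + r s')" for i s
  define a' where "a' p = (if Q (p1 p) (p2 p) then r (p2 p) else 1)" for p
  define b' where "b' p = (if Q (p1 p) (p2 p) then r (p2 p) + (b (p1 p) - l (p1 p)) else 0)" for p
  have l: "computable_rat_seq l" unfolding l_def by (intro comp_intros ab)
  have Q: "decidable (\<lambda>p. Q (p1 p) (p2 p))"
    unfolding Q_def
    by (intro comp_intros rat_seq_comp[OF l] rat_seq_comp[OF q(1)] rat_seq_comp[OF r(1)]
        rat_seq_comp[OF ab(1)] rat_seq_comp[OF ab(2)])
  have Q_unique: "s = s'" if "Q i s" "Q i s'" for i s s'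
    using that unfolding Q_def by (meson linorder_neqE_nat)
  have "solovay_test a' b'"
  proof (rule solovay_testI)
    show "computable_rat_seq a'" "computable_rat_seq b'"
      unfolding a'_def b'_def
      by (intro comp_intros rat_seq_comp[OF l] rat_seq_comp[OF r(1)] rat_seq_comp[OF ab(2)] Q)+
    fix F :: "nat set" assume F: "finite F"
    let ?G = "{p\<in>F. Q (p1 p) (p2 p)}"
    have len: "max 0 (real_of_rat (b' p - a' p)) =
      (if Q (p1 p) (p2 p) then max 0 (real_of_rat (b (p1 p) - a (p1 p))) + (1/2) ^ p1 p else 0)" for p
    proof (cases "Q (p1 p) (p2 p)")
      case True
      then have "a (p1 p) \<le> b (p1 p)" by (simp add: Q_def)
      then have "real_of_rat (b (p1 p) - a (p1 p)) \<ge> 0" by (simp add: of_rat_less_eq)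
      moreover have "real_of_rat (b' p - a' p) = real_of_rat (b (p1 p) - a (p1 p)) + (1/2) ^ p1 p"
        using True by (simp add: a'_def b'_def l_def of_rat_add of_rat_diff of_rat_divide of_rat_power power_one_over)
      ultimately show ?thesis using True by simp
    qed (simp add: a'_def b'_def)
    have "inj_on p1 ?G"
    proof (rule inj_onI)
      fix p p' assume "p \<in> ?G" "p' \<in> ?G" "p1 p = p1 p'"
      moreover from this have "p2 p = p2 p'" using Q_unique[of "p1 p" "p2 p" "p2 p'"] by simp
      ultimately have "prod_decode p = prod_decode p'" by (intro prod_eqI) simp_all
      then show "p = p'" by (metis prod_decode_inverse)
    qed
    have "(\<Sum>p\<in>F. max 0 (real_of_rat (b' p - a' p)))
        = (\<Sum>p\<in>?G. max 0 (real_of_rat (b (p1 p) - a (p1 p))) + (1/2) ^ p1 p)"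
      unfolding len using F by (simp add: sum.If_cases Int_def)
    also have "\<dots> = (\<Sum>i\<in>p1 ` ?G. max 0 (real_of_rat (b i - a i)) + (1/2) ^ i)"
      by (subst sum.reindex[OF \<open>inj_on p1 ?G\<close>]) (simp add: o_def)
    also have "\<dots> = (\<Sum>i\<in>p1 ` ?G. max 0 (real_of_rat (b i - a i))) + (\<Sum>i\<in>p1 ` ?G. (1/2) ^ i)"
      by (rule sum.distrib)
    also have "\<dots> \<le> K + (\<Sum>i. (1/2) ^ i)"
      using F by (intro add_mono K sum_le_suminf) auto
    finally show "(\<Sum>p\<in>F. max 0 (real_of_rat (b' p - a' p))) \<le> K + (\<Sum>i. (1/2) ^ i)" .
  qed
  then have fin: "finite {p. real_of_rat (a' p) \<le> z \<and> z \<le> real_of_rat (b' p)}"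
    using z(2) unfolding solovay_random_def by blast
  show "finite {i. real_of_rat (a i) \<le> y + z \<and> y + z \<le> real_of_rat (b i)}"
  proof (rule finite_subset[OF _ finite_imageI[OF fin, of p1]], rule subsetI)
    fix i assume "i \<in> {i. real_of_rat (a i) \<le> y + z \<and> y + z \<le> real_of_rat (b i)}"
    then have i: "real_of_rat (a i) \<le> y + z" "y + z \<le> real_of_rat (b i)" by auto
    have "0 < 1 / (2::real) ^ i" by simp
    moreover have "real_of_rat (l i) = real_of_rat (a i) - 1 / 2 ^ i"
      by (simp add: l_def of_rat_diff of_rat_divide of_rat_power)
    ultimately have "real_of_rat (l i) < y + z" using i by linarith
    moreover have "(\<lambda>s. real_of_rat (q s + r s)) \<longlonglongrightarrow> y + z"
      using tendsto_add[OF q(2) r(2)] by (simp add: of_rat_add)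
    ultimately have "\<forall>\<^sub>F s in sequentially. real_of_rat (l i) < real_of_rat (q s + r s)"
      by (intro order_tendstoD(1))
    then obtain s0 where "real_of_rat (l i) < real_of_rat (q s0 + r s0)"
      unfolding eventually_sequentially by blast
    then have s0: "l i \<le> q s0 + r s0" unfolding of_rat_less by (rule less_imp_le)
    define s where "s = (LEAST s. l i \<le> q s + r s)"
    have "l i \<le> q s + r s" unfolding s_def by (rule LeastI) fact
    moreover have "\<not> l i \<le> q s' + r s'" if "s' < s" for s'
      using not_less_Least that unfolding s_def .
    moreover have "a i \<le> b i" using order_trans[OF i] by (simp add: of_rat_less_eq)
    ultimately have "Q i s" unfolding Q_def by blast
    have "real_of_rat (l i) \<le> real_of_rat (q s) + real_of_rat (r s)"
      using \<open>l i \<le> q s + r s\<close> by (simp only: of_rat_less_eq of_rat_add[symmetric])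
    \<comment> \<open>Since \<open>q s\<close> is at most \<open>y\<close>, the remainder
      \<open>z - r s\<close> is at most \<open>(y + z) - (q s + r s)\<close>, which is at most
      \<open>b i - l i\<close>.\<close>
    then have "real_of_rat (r s) \<le> z" "z \<le> real_of_rat (r s) + (real_of_rat (b i) - real_of_rat (l i))"
      using r(3)[of s] q(3)[of s] i(2) by linarith+
    then have "prod_encode (i, s) \<in> {p. real_of_rat (a' p) \<le> z \<and> z \<le> real_of_rat (b' p)}"
      using \<open>Q i s\<close> by (simp add: a'_def b'_def of_rat_add of_rat_diff)
    then show "i \<in> p1 ` {p. real_of_rat (a' p) \<le> z \<and> z \<le> real_of_rat (b' p)}"
      by (metis (no_types, lifting) fst_conv image_eqI prod_encode_inverse)
  qed
qed

text \<open>The intervals between consecutive approximations form a Solovay test, so that the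
  approximations of a random real eventually stay on one side of it.\<close>

lemma solovay_random_diff_one_sided:
  assumes "left_ce y" "left_ce z" and random: "solovay_random (y - z)"
  shows "left_ce (y - z) \<or> left_ce (z - y)"
proof -
  obtain q where q: "computable_rat_seq q" "incseq q" "(\<lambda>n. real_of_rat (q n)) \<longlonglongrightarrow> y"
    "\<And>n. real_of_rat (q n) \<le> y" by (rule left_ceE[OF assms(1)]) blast
  obtain r where r: "computable_rat_seq r" "incseq r" "(\<lambda>n. real_of_rat (r n)) \<longlonglongrightarrow> z"
    "\<And>n. real_of_rat (r n) \<le> z" by (rule left_ceE[OF assms(2)]) blast
  define w where "w s = q s - r s" for s
  have w: "computable_rat_seq w" unfolding w_def by (intro comp_intros q r)
  have lim: "(\<lambda>s. real_of_rat (w s)) \<longlonglongrightarrow> y - z"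
    using tendsto_diff[OF q(3) r(3)] by (simp add: w_def of_rat_diff)
  define a where "a s = (if w s \<le> w (Suc s) then w s else w (Suc s))" for s
  define b where "b s = (if w s \<le> w (Suc s) then w (Suc s) else w s)" for s
  have a: "real_of_rat (a s) = min (real_of_rat (w s)) (real_of_rat (w (Suc s)))"
    and b: "real_of_rat (b s) = max (real_of_rat (w s)) (real_of_rat (w (Suc s)))" for s
    by (auto simp: a_def b_def min_def max_def of_rat_less_eq)
  \<comment> \<open>The variation of \<open>w\<close> is at most that of \<open>q\<close> plus that
    of \<open>r\<close>, and for increasing sequences the variation telescopes.\<close>
  have step: "max 0 (real_of_rat (b s - a s)) \<le> (real_of_rat (q (Suc s)) - real_of_rat (q s))
      + (real_of_rat (r (Suc s)) - real_of_rat (r s))" for s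
  proof -
    have "real_of_rat (q s) \<le> real_of_rat (q (Suc s))" "real_of_rat (r s) \<le> real_of_rat (r (Suc s))"
      using q(2) r(2) by (auto simp: incseq_Suc_iff of_rat_less_eq)
    then show ?thesis by (auto simp: a_def b_def w_def of_rat_diff)
  qed
  have nonneg: "0 \<le> (real_of_rat (q (Suc s)) - real_of_rat (q s))
      + (real_of_rat (r (Suc s)) - real_of_rat (r s))" for s
    by (rule order_trans[OF _ step]) simp
  have "solovay_test a b"
  proof (rule solovay_testI)
    show "computable_rat_seq a" "computable_rat_seq b"
      unfolding a_def b_def by (intro comp_intros rat_seq_comp[OF w])+
    fix F :: "nat set" assume "finite F"
    then obtain N where N: "F \<subseteq> {..<N}"
      unfolding finite_nat_set_iff_bounded by blast
    have "(\<Sum>s\<in>F. max 0 (real_of_rat (b s - a s)))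
        \<le> (\<Sum>s\<in>F. (real_of_rat (q (Suc s)) - real_of_rat (q s)) + (real_of_rat (r (Suc s)) - real_of_rat (r s)))"
      by (rule sum_mono) (rule step)
    also have "\<dots> \<le> (\<Sum>s<N. (real_of_rat (q (Suc s)) - real_of_rat (q s)) + (real_of_rat (r (Suc s)) - real_of_rat (r s)))"
      using N nonneg by (intro sum_mono2) auto
    also have "\<dots> = (real_of_rat (q N) - real_of_rat (q 0)) + (real_of_rat (r N) - real_of_rat (r 0))"
      unfolding sum.distrib using sum_lessThan_telescope[of "\<lambda>s. real_of_rat (q s)" N]
        sum_lessThan_telescope[of "\<lambda>s. real_of_rat (r s)" N] by simp
    also have "\<dots> \<le> (y - real_of_rat (q 0)) + (z - real_of_rat (r 0))"
      using q(4)[of N] r(4)[of N] by simp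
    finally show "(\<Sum>s\<in>F. max 0 (real_of_rat (b s - a s))) \<le> (y - real_of_rat (q 0)) + (z - real_of_rat (r 0))" .
  qed
  then have "finite {s. real_of_rat (a s) \<le> y - z \<and> y - z \<le> real_of_rat (b s)}"
    using random unfolding solovay_random_def by blast
  then obtain N where "{s. real_of_rat (a s) \<le> y - z \<and> y - z \<le> real_of_rat (b s)} \<subseteq> {..<N}"
    unfolding finite_nat_set_iff_bounded by blast
  then have N: "\<not> (real_of_rat (a s) \<le> y - z \<and> y - z \<le> real_of_rat (b s))" if "s \<ge> N" for s
    using that by (auto simp: not_less)
  show ?thesis
  proof (cases "real_of_rat (w N) \<le> y - z")
    case True
    have "real_of_rat (w s) \<le> y - z" if "s \<ge> N" for s
      using that
    proof (induction s rule: dec_induct)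
      case (step s)
      with N[of s] show ?case unfolding a b by linarith
    qed (fact True)
    then show ?thesis using left_ce_lower_limit[OF w lim] by blast
  next
    case False
    have "y - z \<le> real_of_rat (w s)" if "s \<ge> N" for s
      using that
    proof (induction s rule: dec_induct)
      case (step s)
      with N[of s] show ?case unfolding a b by linarith
    qed (use False in simp)
    then have "real_of_rat (- w s) \<le> z - y" if "s \<ge> N" for s
      using that by (force simp: of_rat_minus)
    moreover have "(\<lambda>s. real_of_rat (- w s)) \<longlonglongrightarrow> z - y"
      using tendsto_minus[OF lim] by (simp add: of_rat_minus)
    ultimately show ?thesis
      using left_ce_lower_limit[OF rat_seq_uminus[OF w]] by blast
  qed
qed

section \<open>Oscillation of approximations\<close>

text \<open>The marker of level \<open>Suc j\<close> at stage \<open>v\<close> sits at the first maximum of \<open>w j\<close> after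
  the marker of level \<open>j\<close>. It is reset whenever a new maximum appears or a lower marker is reset.\<close>

definition marker :: "(nat \<Rightarrow> nat \<Rightarrow> rat) \<Rightarrow> nat \<Rightarrow> nat \<Rightarrow> nat" where
  "marker w j v = rec_nat 0 (\<lambda>j r. argmax (w j) r v) j"

text \<open>The index is shifted because \<open>w j\<close> determines the marker of level
  \<open>Suc j\<close>.\<close>

definition kept :: "(nat \<Rightarrow> nat \<Rightarrow> rat) \<Rightarrow> nat \<Rightarrow> nat \<Rightarrow> bool" where
  "kept w j v \<longleftrightarrow> marker w (Suc j) (Suc v) = marker w (Suc j) v"

lemma marker_0 [simp]: "marker w 0 v = 0"
  by (simp add: marker_def)

lemma marker_Suc: "marker w (Suc j) v = argmax (w j) (marker w j v) v"
  by (simp add: marker_def)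

lemma computable_marker:
  assumes w: "computable_rat_seq (\<lambda>p. w (p1 p) (p2 p))"
  shows "computable (\<lambda>p. marker w (p1 p) (p2 p))"
  unfolding marker_def by (intro computable_rec computable_argmax[OF w] comp_intros)

lemma marker_le: "marker w j v \<le> v"
  by (induction j) (simp_all add: marker_Suc argmax_bounds)

lemma marker_mono_level: "marker w j v \<le> marker w (Suc j) v"
  by (simp add: marker_Suc argmax_bounds marker_le)

lemma marker_ge: "marker w j v \<le> u \<Longrightarrow> u \<le> v \<Longrightarrow> w j u \<le> w j (marker w (Suc j) v)"
  by (simp add: marker_Suc argmax_ge)

lemma marker_step: "marker w j (Suc v) = marker w j v \<or> marker w j (Suc v) = Suc v"
proof (induction j)
  case (Suc j)
  then show ?case
  proof
    assume "marker w j (Suc v) = marker w j v"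
    then show ?thesis by (auto simp: marker_Suc argmax_Suc)
  next
    assume "marker w j (Suc v) = Suc v"
    then show ?thesis by (simp add: marker_Suc argmax_start)
  qed
qed simp

text \<open>A reset moves a marker to the current stage, and higher markers lie at or after lower
  ones, so a reset forces one at all higher levels. This nesting of kept stages is what lets the
  savings of successive levels multiply.\<close>

lemma kept_lower: "kept w (Suc j) v \<Longrightarrow> kept w j v"
  using marker_step[of w "Suc j" v] marker_mono_level[of w "Suc j" "Suc v"] marker_le[of w "Suc (Suc j)" v]
  unfolding kept_def by auto

lemma marker_between: "marker w j v = r \<Longrightarrow> r \<le> u \<Longrightarrow> u \<le> v \<Longrightarrow> marker w j u = r"
proof (induction v)
  case (Suc v)
  then show ?case using marker_step[of w j v] by (cases "u = Suc v") auto
qed simp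

text \<open>While the marker is kept, both sides change by the same increment. At a reset the right
  side becomes 0 and the increment is dropped; the sum so far was at most 0, because the old marker
  stood at a maximum. Withdrawn markers therefore never add to the balance.\<close>

lemma kept_sum_le:
  "(\<Sum>u<v. if kept w j u then w j (Suc u) - w j u else 0) \<le> w j v - w j (marker w (Suc j) v)"
proof (induction v)
  case 0
  then show ?case using marker_le[of w "Suc j" 0] by simp
next
  case (Suc v)
  show ?case
  proof (cases "kept w j v")
    case True
    then show ?thesis using Suc by (simp add: kept_def)
  next
    case False
    then have "marker w (Suc j) (Suc v) = Suc v"
      using marker_step[of w "Suc j" v] by (auto simp: kept_def)
    then show ?thesis
      using Suc False marker_ge[of w j v v] marker_le[of w j v] by simp
  qed
qed

lemma kept_sum_nonpos: "(\<Sum>u<v. if kept w j u then w j (Suc u) - w j u else 0) \<le> 0"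
  using kept_sum_le[of w j v] marker_ge[of w j v v] marker_le[of w j v] by simp

text \<open>Once the lower marker rests at \<open>N\<close>, a value above \<open>L j\<close> after
  \<open>N\<close> beats all late values, as these tend to \<open>L j\<close>, so the maximum stops
  moving. The number \<open>M\<close> is both the final position and a stage from which it is
  assumed, since a marker only ever jumps to the current stage.\<close>

lemma marker_stable:
  assumes lim: "\<And>j. (\<lambda>s. real_of_rat (w j s)) \<longlonglongrightarrow> L j"
    and above: "\<And>j N. \<exists>s\<ge>N. real_of_rat (w j s) > L j"
  shows "\<exists>M. \<forall>v\<ge>M. marker w j v = M"
    and "\<exists>M. (\<forall>v\<ge>M. marker w (Suc j) v = M) \<and> real_of_rat (w j M) > L j"
proof -
  have step: "\<exists>M. (\<forall>v\<ge>M. marker w (Suc j) v = M) \<and> real_of_rat (w j M) > L j"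
    if N: "\<And>v. v \<ge> N \<Longrightarrow> marker w j v = N" for j N
  proof -
    obtain s where s: "s \<ge> N" "real_of_rat (w j s) > L j" using above by blast
    from order_tendstoD(2)[OF lim s(2)] obtain V where
      V: "\<And>v. v \<ge> V \<Longrightarrow> real_of_rat (w j v) < real_of_rat (w j s)"
      unfolding eventually_sequentially by blast
    define T where "T = max V s"
    have ge: "w j s \<le> w j (marker w (Suc j) v)" if "v \<ge> T" for v
      using that s N[of v] by (intro marker_ge) (auto simp: T_def)
    have const: "marker w (Suc j) v = marker w (Suc j) T" if "v \<ge> T" for v
      using that
    proof (induction v rule: dec_induct)
      case (step v)
      have "marker w (Suc j) (Suc v) \<noteq> Suc v"
        using ge[of "Suc v"] V[of "Suc v"] step by (auto simp: T_def of_rat_less)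
      then show ?case using marker_step[of w "Suc j" v] step by simp
    qed simp
    define M where "M = marker w (Suc j) T"
    have "M \<le> T" unfolding M_def by (rule marker_le)
    have "marker w (Suc j) v = M" if "v \<ge> M" for v
    proof (cases "v \<ge> T")
      case True
      then show ?thesis unfolding M_def by (rule const)
    next
      case False
      then show ?thesis using that by (intro marker_between[of w "Suc j" T M v]) (simp_all add: M_def)
    qed
    moreover have "real_of_rat (w j s) \<le> real_of_rat (w j M)"
      using ge[of T] by (simp add: M_def of_rat_less_eq)
    ultimately show ?thesis using s(2) by (intro exI[of _ M]) auto
  qed
  show 1: "\<exists>M. \<forall>v\<ge>M. marker w j v = M" for j
  proof (induction j)
    case (Suc j)
    then show ?case using step by blast
  qed (auto intro: exI[of _ 0])
  show "\<exists>M. (\<forall>v\<ge>M. marker w (Suc j) v = M) \<and> real_of_rat (w j M) > L j"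
    using 1[of j] step by blast
qed

text \<open>While a marker \<open>m\<close> of level \<open>j\<close> is kept, the interval from \<open>A m\<close> to
  \<open>A m + r j * (B v - B m)\<close> is added to the test piece by piece. The final marker \<open>m\<close> of the
  level is a maximum above the limit, which says that this interval finally covers the limit of
  \<open>A\<close>.\<close>

lemma not_solovay_random_markers:
  assumes A: "computable_rat_seq A" "\<And>s. real_of_rat (A s) \<le> \<alpha>"
    and B: "computable_rat_seq B" "incseq B" "(\<lambda>s. real_of_rat (B s)) \<longlonglongrightarrow> \<beta>"
    and w: "computable_rat_seq (\<lambda>p. w (p1 p) (p2 p))"
    and lim: "\<And>j. (\<lambda>s. real_of_rat (w j s)) \<longlonglongrightarrow> L j"
    and above: "\<And>j N. \<exists>s\<ge>N. real_of_rat (w j s) > L j"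
    and r: "computable_rat_seq r" "\<And>j. r j \<ge> 0"
    and P: "decidable P" "infinite {j. P j}"
    and wP: "\<And>j s. P j \<Longrightarrow> w j s = A s - r j * B s"
    and LP: "\<And>j. P j \<Longrightarrow> L j = \<alpha> - real_of_rat (r j) * \<beta>"
    and bound: "\<And>J v. finite J \<Longrightarrow> J \<subseteq> {j. P j} \<Longrightarrow>
      (\<Sum>j\<in>J. real_of_rat (r j * (\<Sum>u<v. if kept w j u then B (Suc u) - B u else 0))) \<le> K"
  shows "\<not> solovay_random \<alpha>"
proof
  assume random: "solovay_random \<alpha>"
  define V where "V p \<longleftrightarrow> P (p1 p) \<and> kept w (p1 p) (p2 p)" for p
  define m where "m p = marker w (Suc (p1 p)) (p2 p)" for p
  \<comment> \<open>An index codes a level and a stage. Consecutive stages with the same marker give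
    adjacent pieces, which together grow to the right from \<open>A (m p)\<close>.\<close>
  define a where "a p = (if V p then A (m p) + r (p1 p) * (B (p2 p) - B (m p)) else 1)" for p
  define b where "b p = (if V p then A (m p) + r (p1 p) * (B (Suc (p2 p)) - B (m p)) else 0)" for p
  note marker = computable2[OF computable_marker[OF w]]
  have V: "decidable V" unfolding V_def kept_def by (intro comp_intros decidable_comp[OF P(1)] marker)
  have m: "computable m" unfolding m_def by (intro comp_intros marker)
  have incB: "B u \<le> B (Suc u)" for u using B(2) by (simp add: incseq_Suc_iff)
  have "solovay_test a b"
  proof (rule solovay_testI)
    show "computable_rat_seq a" "computable_rat_seq b"
      unfolding a_def b_def
      by (intro comp_intros V rat_seq_comp[OF A(1)] rat_seq_comp[OF B(1)] rat_seq_comp[OF r(1)] m)+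
    fix F :: "nat set" assume F: "finite F"
    define J where "J = {j \<in> p1 ` F. P j}"
    obtain N where N: "p2 ` F \<subseteq> {..<N}"
      using finite_imageI[OF F, of p2] unfolding finite_nat_set_iff_bounded by blast
    define g where "g = (\<lambda>(j, u). real_of_rat (r j) * (if kept w j u then real_of_rat (B (Suc u) - B u) else 0))"
    have g0: "g x \<ge> 0" for x
      using r(2) incB by (auto simp: g_def case_prod_beta of_rat_less_eq intro!: mult_nonneg_nonneg)
    have "max 0 (real_of_rat (b p - a p)) = (if V p then g (prod_decode p) else 0)" for p
    proof (cases "V p")
      case True
      then have "b p - a p = r (p1 p) * (B (Suc (p2 p)) - B (p2 p))"
        by (simp add: a_def b_def algebra_simps)
      then have "real_of_rat (b p - a p) = g (prod_decode p)"
        using True by (simp add: g_def case_prod_beta V_def of_rat_mult)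
      then show ?thesis using True g0[of "prod_decode p"] by simp
    qed (simp add: a_def b_def)
    then have "(\<Sum>p\<in>F. max 0 (real_of_rat (b p - a p))) = (\<Sum>p\<in>{p\<in>F. V p}. g (prod_decode p))"
      using F by (simp add: sum.If_cases Int_def)
    also have "\<dots> = (\<Sum>x\<in>prod_decode ` {p\<in>F. V p}. g x)"
      by (subst sum.reindex) (auto simp: inj_on_def dest: injD[OF inj_prod_decode])
    \<comment> \<open>Enlarging to a full rectangle of levels and stages is harmless as all lengths
      are nonnegative, and it puts the sum into the form of \<open>bound\<close>.\<close>
    also have "\<dots> \<le> (\<Sum>x\<in>J \<times> {..<N}. g x)"
    proof (rule sum_mono2)
      show "finite (J \<times> {..<N})" using F by (simp add: J_def)
      show "prod_decode ` {p\<in>F. V p} \<subseteq> J \<times> {..<N}"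
      proof
        fix x assume "x \<in> prod_decode ` {p\<in>F. V p}"
        then obtain p where p: "p \<in> F" "V p" "x = prod_decode p" by auto
        moreover have "p2 p < N" using p(1) N by auto
        ultimately show "x \<in> J \<times> {..<N}" by (auto simp: J_def V_def mem_Times_iff)
      qed
    qed (rule g0)
    also have "\<dots> = (\<Sum>j\<in>J. \<Sum>u<N. g (j, u))"
      by (simp add: sum.cartesian_product)
    also have "\<dots> = (\<Sum>j\<in>J. real_of_rat (r j * (\<Sum>u<N. if kept w j u then B (Suc u) - B u else 0)))"
    proof (rule sum.cong[OF refl])
      fix j
      have "(\<Sum>u<N. g (j, u)) = real_of_rat (r j) *
          (\<Sum>u<N. real_of_rat (if kept w j u then B (Suc u) - B u else 0))"
        unfolding sum_distrib_left by (rule sum.cong) (auto simp: g_def)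
      then show "(\<Sum>u<N. g (j, u)) =
          real_of_rat (r j * (\<Sum>u<N. if kept w j u then B (Suc u) - B u else 0))"
        by (simp only: of_rat_mult of_rat_sum)
    qed
    also have "\<dots> \<le> K" using F by (intro bound) (auto simp: J_def)
    finally show "(\<Sum>p\<in>F. max 0 (real_of_rat (b p - a p))) \<le> K" .
  qed
  then have fin: "finite {p. real_of_rat (a p) \<le> \<alpha> \<and> \<alpha> \<le> real_of_rat (b p)}"
    using random unfolding solovay_random_def by blast
  have "{j. P j} \<subseteq> p1 ` {p. real_of_rat (a p) \<le> \<alpha> \<and> \<alpha> \<le> real_of_rat (b p)}"
  proof
    fix j assume "j \<in> {j. P j}"
    then have j: "P j" by simp
    obtain M where M: "\<And>v. v \<ge> M \<Longrightarrow> marker w (Suc j) v = M" and "real_of_rat (w j M) > L j"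
      using marker_stable(2)[of w L j] lim above by metis
    \<comment> \<open>The overshoot of \<open>w j\<close> at \<open>M\<close>, rearranged: the
      pieces for the final marker eventually reach beyond \<alpha>.\<close>
    then have less: "\<alpha> < real_of_rat (A M) + real_of_rat (r j) * (\<beta> - real_of_rat (B M))"
      by (simp add: wP[OF j] LP[OF j] of_rat_diff of_rat_mult algebra_simps)
    define e where "e v = real_of_rat (A M) + real_of_rat (r j) * (real_of_rat (B v) - real_of_rat (B M))" for v
    have "e \<longlonglongrightarrow> real_of_rat (A M) + real_of_rat (r j) * (\<beta> - real_of_rat (B M))"
      unfolding e_def by (intro tendsto_intros B(3))
    from order_tendstoD(1)[OF this less] obtain T where T: "\<And>v. v \<ge> T \<Longrightarrow> \<alpha> < e v"
      unfolding eventually_sequentially by blast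
    \<comment> \<open>The first piece whose right end reaches \<alpha>. Its left end is at most
      \<alpha>, either as the end of the previous piece or because the pieces start at
      \<open>A M\<close>.\<close>
    define v where "v = (LEAST v. M \<le> v \<and> \<alpha> \<le> e (Suc v))"
    have "M \<le> max M T \<and> \<alpha> \<le> e (Suc (max M T))" using T[of "Suc (max M T)"] by (simp add: le_SucI)
    then have "M \<le> v \<and> \<alpha> \<le> e (Suc v)" unfolding v_def by (rule LeastI)
    then have v: "M \<le> v" "\<alpha> \<le> e (Suc v)" by auto
    have "e v \<le> \<alpha>"
    proof (cases "v = M")
      case True
      then show ?thesis using A(2)[of M] by (simp add: e_def)
    next
      case False
      with v(1) obtain v' where v': "v = Suc v'" "M \<le> v'" by (cases v) auto
      then have "\<not> (M \<le> v' \<and> \<alpha> \<le> e (Suc v'))"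
        using not_less_Least[of v' "\<lambda>v. M \<le> v \<and> \<alpha> \<le> e (Suc v)"] unfolding v_def[symmetric] by simp
      then show ?thesis using v' by simp
    qed
    moreover have "V (prod_encode (j, v))" "m (prod_encode (j, v)) = M"
      using j v(1) M by (simp_all add: V_def m_def kept_def)
    ultimately have "prod_encode (j, v) \<in> {p. real_of_rat (a p) \<le> \<alpha> \<and> \<alpha> \<le> real_of_rat (b p)}"
      using v(2) by (simp add: a_def b_def e_def of_rat_add of_rat_mult of_rat_diff)
    then show "j \<in> p1 ` {p. real_of_rat (a p) \<le> \<alpha> \<and> \<alpha> \<le> real_of_rat (b p)}"
      by (metis (no_types, lifting) fst_conv image_eqI prod_encode_inverse)
  qed
  with fin P(2) show False by (meson finite_imageI finite_subset)
qed

section \<open>The Kucera-Slaman theorem and the dichotomy of slopes\<close>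

lemma kept_sum_B_le:
  assumes "incseq B" "\<And>s. real_of_rat (B s) \<le> \<beta>"
  shows "real_of_rat (\<Sum>u<v. if kept w j u then B (Suc u) - B u else 0) \<le> \<beta> - real_of_rat (B 0)"
proof -
  have "(\<Sum>u<v. if kept w j u then B (Suc u) - B u else 0) \<le> (\<Sum>u<v. B (Suc u) - B u)"
    using assms(1) by (intro sum_mono) (auto simp: incseq_Suc_iff)
  also have "\<dots> = B v - B 0" by (rule sum_lessThan_telescope)
  finally have "real_of_rat (\<Sum>u<v. if kept w j u then B (Suc u) - B u else 0)
      \<le> real_of_rat (B v) - real_of_rat (B 0)"
    unfolding of_rat_diff[symmetric] of_rat_less_eq .
  with assms(2)[of v] show ?thesis by linarith
qed

text \<open>If every \<open>q\<close> fails, the powers of 2 fail, so \<open>A - B / 2 ^ j\<close>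
  overshoots infinitely often for every \<open>j\<close>. A level then costs at most
  \<open>1 / 2 ^ j\<close> times the total growth of \<open>B\<close>, which is summable without any
  comparison between levels.\<close>

theorem kucera_slaman:
  assumes "left_ce \<alpha>" "solovay_random \<alpha>" "left_ce \<beta>"
  shows "\<exists>q>0. left_ce (real_of_rat q * \<alpha> - \<beta>)"
proof (rule ccontr)
  assume "\<not> ?thesis"
  then have no: "\<not> left_ce (real_of_rat q * \<alpha> - \<beta>)" if "q > 0" for q
    using that by blast
  obtain A where A: "computable_rat_seq A" "incseq A" "(\<lambda>n. real_of_rat (A n)) \<longlonglongrightarrow> \<alpha>"
    "\<And>n. real_of_rat (A n) \<le> \<alpha>" by (rule left_ceE[OF assms(1)]) blast
  obtain B where B: "computable_rat_seq B" "incseq B" "(\<lambda>n. real_of_rat (B n)) \<longlonglongrightarrow> \<beta>"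
    "\<And>n. real_of_rat (B n) \<le> \<beta>" by (rule left_ceE[OF assms(3)]) blast
  define w where "w j s = A s - 1 / 2 ^ j * B s" for j s :: nat
  define L where "L j = \<alpha> - real_of_rat (1 / 2 ^ j) * \<beta>" for j :: nat
  have w: "computable_rat_seq (\<lambda>p. w (p1 p) (p2 p))"
    unfolding w_def by (intro comp_intros rat_seq_comp[OF A(1)] rat_seq_comp[OF B(1)])
  have lim: "(\<lambda>s. real_of_rat (w j s)) \<longlonglongrightarrow> L j" for j
    unfolding w_def L_def of_rat_diff of_rat_mult by (intro tendsto_intros A B)
  have "\<not> left_ce (L j)" for j
  proof
    assume "left_ce (L j)"
    then have "left_ce (real_of_rat (2 ^ j) * L j)" by (rule left_ce_scale) simp
    moreover have "real_of_rat (2 ^ j) * L j = real_of_rat (2 ^ j) * \<alpha> - \<beta>"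
      by (simp add: L_def of_rat_power of_rat_divide algebra_simps)
    ultimately show False using no[of "2 ^ j"] by simp
  qed
  moreover have "computable_rat_seq (w j)" for j
    unfolding w_def by (intro comp_intros A B)
  ultimately have above: "\<exists>s\<ge>N. real_of_rat (w j s) > L j" for j N
    using not_left_ce_above lim by blast
  have "\<not> solovay_random \<alpha>"
  proof (rule not_solovay_random_markers[OF A(1,4) B(1-3) w lim above])
    show "computable_rat_seq (\<lambda>j. 1 / 2 ^ j)" "decidable (\<lambda>_. 0 \<le> (0::nat))"
      by (intro comp_intros)+
    fix J :: "nat set" and v assume J: "finite J"
    have "(\<Sum>j\<in>J. real_of_rat (1 / 2 ^ j * (\<Sum>u<v. if kept w j u then B (Suc u) - B u else 0)))
        \<le> (\<Sum>j\<in>J. (1/2) ^ j * (\<beta> - real_of_rat (B 0)))"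
    proof (rule sum_mono)
      fix j
      have "real_of_rat (1 / 2 ^ j) = (1/2) ^ j" by (simp add: of_rat_divide of_rat_power power_one_over)
      then show "real_of_rat (1 / 2 ^ j * (\<Sum>u<v. if kept w j u then B (Suc u) - B u else 0))
          \<le> (1/2) ^ j * (\<beta> - real_of_rat (B 0))"
        unfolding of_rat_mult by (simp only:) (intro mult_left_mono kept_sum_B_le B, simp)
    qed
    also have "\<dots> \<le> (\<Sum>j. (1/2) ^ j) * (\<beta> - real_of_rat (B 0))"
      unfolding sum_distrib_right[symmetric]
      using J B(4)[of 0] by (intro mult_right_mono sum_le_suminf) auto
    finally show "(\<Sum>j\<in>J. real_of_rat (1 / 2 ^ j * (\<Sum>u<v. if kept w j u then B (Suc u) - B u else 0)))
        \<le> (\<Sum>j. (1/2) ^ j) * (\<beta> - real_of_rat (B 0))" .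
  qed (auto simp: w_def L_def)
  with assms(2) show False by blast
qed

text \<open>Otherwise both \<open>A - B / d\<close> and \<open>B - c * A\<close> exceed their limits infinitely often. Alternating
  between them, each pair of levels shrinks the measure by the factor \<open>c / d\<close>.\<close>

theorem left_ce_dichotomy:
  assumes "left_ce \<alpha>" "solovay_random \<alpha>" "left_ce \<beta>" "0 < c" "c < d"
  shows "left_ce (real_of_rat d * \<alpha> - \<beta>) \<or> left_ce (\<beta> - real_of_rat c * \<alpha>)"
proof (rule ccontr)
  assume no: "\<not> ?thesis"
  obtain A where A: "computable_rat_seq A" "incseq A" "(\<lambda>n. real_of_rat (A n)) \<longlonglongrightarrow> \<alpha>"
    "\<And>n. real_of_rat (A n) \<le> \<alpha>" by (rule left_ceE[OF assms(1)]) blast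
  obtain B where B: "computable_rat_seq B" "incseq B" "(\<lambda>n. real_of_rat (B n)) \<longlonglongrightarrow> \<beta>"
    "\<And>n. real_of_rat (B n) \<le> \<beta>" by (rule left_ceE[OF assms(3)]) blast
  have "d > 0" using assms by simp
  define w where "w j s = (if j mod 2 = 0 then A s - 1 / d * B s else B s - c * A s)" for j s :: nat
  define L where "L j = (if j mod 2 = 0 then \<alpha> - real_of_rat (1 / d) * \<beta> else \<beta> - real_of_rat c * \<alpha>)" for j :: nat
  have w: "computable_rat_seq (\<lambda>p. w (p1 p) (p2 p))"
    unfolding w_def by (intro comp_intros rat_seq_comp[OF A(1)] rat_seq_comp[OF B(1)])
  have lim: "(\<lambda>s. real_of_rat (w j s)) \<longlonglongrightarrow> L j" for j
  proof (cases "j mod 2 = 0")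
    case True
    show ?thesis unfolding w_def L_def if_P[OF True] of_rat_diff of_rat_mult
      by (intro tendsto_intros A B)
  next
    case False
    show ?thesis unfolding w_def L_def if_not_P[OF False] of_rat_diff of_rat_mult
      by (intro tendsto_intros A B)
  qed
  have "\<not> left_ce (L j)" for j
  proof
    assume L: "left_ce (L j)"
    show False
    proof (cases "j mod 2 = 0")
      case True
      have "left_ce (real_of_rat d * L j)" using \<open>d > 0\<close> by (intro left_ce_scale L) simp
      moreover have "real_of_rat d * L j = real_of_rat d * \<alpha> - \<beta>"
        using True \<open>d > 0\<close> by (simp add: L_def of_rat_divide algebra_simps)
      ultimately show False using no by simp
    next
      case False
      then show False using L no by (simp add: L_def)
    qed
  qed
  moreover have "computable_rat_seq (w j)" for j
    using rat_seq2[OF w computable_const[of j] computable_id] .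
  ultimately have above: "\<exists>s\<ge>N. real_of_rat (w j s) > L j" for j N
    using not_left_ce_above lim by blast
  \<comment> \<open>The total growth of \<open>B\<close>, and with \<open>T\<close> that of
    \<open>A\<close>, over the kept stages of a level.\<close>
  define S where "S j v = (\<Sum>u<v. if kept w j u then B (Suc u) - B u else 0)" for j v
  define T where "T j v = (\<Sum>u<v. if kept w j u then A (Suc u) - A u else 0)" for j v
  have S_Suc: "S (Suc j) v \<le> S j v" for j v
    unfolding S_def using B(2) kept_lower[of w j] by (intro sum_mono) (auto simp: incseq_Suc_iff)
  have T_Suc: "T (Suc j) v \<le> T j v" for j v
    unfolding T_def using A(2) kept_lower[of w j] by (intro sum_mono) (auto simp: incseq_Suc_iff)
  \<comment> \<open>The absence of a net gain of \<open>w j\<close> on its kept stages, written as a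
    comparison of the growth of \<open>A\<close> and of \<open>B\<close>; the odd levels give the
    reverse comparison with \<open>c\<close>.\<close>
  have even: "T j v \<le> 1 / d * S j v" if "j mod 2 = 0" for j v
  proof -
    have "T j v - 1 / d * S j v = (\<Sum>u<v. if kept w j u then w j (Suc u) - w j u else 0)"
      unfolding T_def S_def sum_distrib_left sum_subtractf[symmetric]
      using that by (intro sum.cong) (auto simp: w_def algebra_simps diff_divide_distrib)
    with kept_sum_nonpos[of w j v] show ?thesis by simp
  qed
  have odd: "S j v \<le> c * T j v" if "j mod 2 \<noteq> 0" for j v
  proof -
    have "S j v - c * T j v = (\<Sum>u<v. if kept w j u then w j (Suc u) - w j u else 0)"
      unfolding T_def S_def sum_distrib_left sum_subtractf[symmetric]
      using that by (intro sum.cong) (auto simp: w_def algebra_simps)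
    with kept_sum_nonpos[of w j v] show ?thesis by simp
  qed
  \<comment> \<open>The odd level in between bounds the growth of \<open>B\<close> by
    \<open>c\<close> times that of \<open>A\<close>, the even level bounds the latter by
    \<open>1 / d\<close> times the growth of \<open>B\<close>, and nesting of the kept stages joins
    the two.\<close>
  have S_step: "S (Suc (Suc j)) v \<le> c / d * S j v" if j: "j mod 2 = 0" for j v
  proof -
    have "Suc j mod 2 \<noteq> 0" using j by presburger
    have "S (Suc (Suc j)) v \<le> S (Suc j) v" by (rule S_Suc)
    also have "\<dots> \<le> c * T (Suc j) v" by (rule odd) fact
    also have "\<dots> \<le> c * T j v" using assms(4) by (intro mult_left_mono T_Suc) simp
    also have "\<dots> \<le> c * (1 / d * S j v)" using assms(4) by (intro mult_left_mono even j) simp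
    finally show ?thesis by simp
  qed
  have S_geo: "S (2 * k) v \<le> (c / d) ^ k * S 0 v" for k v
  proof (induction k)
    case (Suc k)
    have "S (2 * Suc k) v \<le> c / d * S (2 * k) v" using S_step[of "2 * k" v] by simp
    also have "\<dots> \<le> c / d * ((c / d) ^ k * S 0 v)"
      using assms(4) \<open>d > 0\<close> by (intro mult_left_mono Suc) simp
    finally show ?case by (simp add: mult.assoc)
  qed simp
  define x where "x = real_of_rat (c / d)"
  have x: "0 \<le> x" "x < 1"
    using assms(4,5) unfolding x_def by (simp_all add: of_rat_less_1_iff)
  define C where "C = real_of_rat (1 / d) * (\<beta> - real_of_rat (B 0))"
  have C: "C \<ge> 0" unfolding C_def using \<open>d > 0\<close> B(4)[of 0] by (intro mult_nonneg_nonneg) auto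
  have "\<not> solovay_random \<alpha>"
  proof (rule not_solovay_random_markers[OF A(1,4) B(1-3) w lim above])
    \<comment> \<open>Only even levels contribute intervals around \<alpha>; odd levels serve to
      shrink what the next even level may cost.\<close>
    show "computable_rat_seq (\<lambda>_. 1 / d)" "decidable (\<lambda>j. j mod 2 = 0)"
      by (intro comp_intros)+
    show "infinite {j::nat. j mod 2 = 0}"
    proof
      assume "finite {j::nat. j mod 2 = 0}"
      then have "finite (range (\<lambda>k::nat. 2 * k))" by (rule rev_finite_subset) auto
      then show False by (simp add: finite_image_iff inj_def)
    qed
    fix J :: "nat set" and v assume J: "finite J" "J \<subseteq> {j. j mod 2 = 0}"
    have "(\<Sum>j\<in>J. real_of_rat (1 / d * S j v)) \<le> (\<Sum>j\<in>J. x ^ (j div 2) * C)"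
    proof (rule sum_mono)
      fix j assume "j \<in> J"
      then have j: "j = 2 * (j div 2)" using J(2) by auto
      have "S j v \<le> (c / d) ^ (j div 2) * S 0 v" using S_geo[of "j div 2" v] j by simp
      then have "real_of_rat (S j v) \<le> x ^ (j div 2) * real_of_rat (S 0 v)"
        unfolding x_def of_rat_power[symmetric] of_rat_mult[symmetric] of_rat_less_eq .
      also have "\<dots> \<le> x ^ (j div 2) * (\<beta> - real_of_rat (B 0))"
        unfolding S_def using x by (intro mult_left_mono kept_sum_B_le B) auto
      finally have "real_of_rat (1 / d) * real_of_rat (S j v)
          \<le> real_of_rat (1 / d) * (x ^ (j div 2) * (\<beta> - real_of_rat (B 0)))"
        using \<open>d > 0\<close> by (intro mult_left_mono) auto
      then show "real_of_rat (1 / d * S j v) \<le> x ^ (j div 2) * C"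
        unfolding C_def of_rat_mult by (simp only: mult_ac)
    qed
    also have "\<dots> = (\<Sum>k\<in>(\<lambda>j. j div 2) ` J. x ^ k) * C"
    proof -
      have "inj_on (\<lambda>j. j div 2) J"
      proof (rule inj_onI)
        fix i j assume "i \<in> J" "j \<in> J" "i div 2 = j div 2"
        moreover from this have "i mod 2 = 0" "j mod 2 = 0" using J(2) by auto
        ultimately show "i = j" by (metis div_mult_mod_eq)
      qed
      then show ?thesis by (simp add: sum.reindex o_def sum_distrib_right)
    qed
    also have "\<dots> \<le> (\<Sum>k. x ^ k) * C"
      using x J(1) by (intro mult_right_mono C sum_le_suminf summable_geometric) auto
    finally show "(\<Sum>j\<in>J. real_of_rat (1 / d * (\<Sum>u<v. if kept w j u then B (Suc u) - B u else 0)))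
        \<le> (\<Sum>k. x ^ k) * C" unfolding S_def .
  qed (use \<open>d > 0\<close> in \<open>auto simp: w_def L_def\<close>)
  with assms(2) show False by blast
qed

section \<open>The three cases for the infimum of the admissible slopes\<close>

theorem theorem1p6:
  fixes \<alpha> \<beta> :: real
  assumes "left_ce \<alpha>" and "mloef_random_real \<alpha>"
    and "left_ce \<beta>" and "mloef_random_real \<beta>"
  shows "(Dist \<alpha> \<beta> < 1 \<longrightarrow> mloef_random_real (\<alpha> - \<beta>) \<and> left_ce (\<alpha> - \<beta>))
       \<and> (Dist \<alpha> \<beta> = 1 \<longrightarrow> \<not> mloef_random_real (\<alpha> - \<beta>))
       \<and> (Dist \<alpha> \<beta> > 1 \<longrightarrow> mloef_random_real (\<alpha> - \<beta>) \<and> right_ce (\<alpha> - \<beta>))"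
proof -
  have random: "solovay_random \<alpha>" using assms(2) by (simp add: mloef_random_real_iff)
  define Q where "Q = {q::rat. q > 0 \<and> left_ce (real_of_rat q * \<alpha> - \<beta>)}"
  have D: "Dist \<alpha> \<beta> = Inf (real_of_rat ` Q)"
    unfolding Dist_def Q_def by (rule arg_cong[of _ _ Inf]) auto
  \<comment> \<open>Without an element of \<open>Q\<close> the infimum would be a meaningless
    default value, and its elements could not be approximated from above.\<close>
  have "Q \<noteq> {}" using kucera_slaman[OF assms(1) random assms(3)] by (auto simp: Q_def)
  then have ne: "real_of_rat ` Q \<noteq> {}" by simp
  have bdd: "bdd_below (real_of_rat ` Q)" by (rule bdd_belowI[of _ 0]) (auto simp: Q_def)
  have Q_less: "\<exists>q\<in>Q. real_of_rat q < y" if "Dist \<alpha> \<beta> < y" for y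
    using that cInf_lessD[OF ne] unfolding D by auto
  have Q_ge: "Dist \<alpha> \<beta> \<le> real_of_rat q" if "q \<in> Q" for q
    unfolding D using that by (intro cInf_lower bdd) auto

  have a: "solovay_random (\<alpha> - \<beta>) \<and> left_ce (\<alpha> - \<beta>)" if "Dist \<alpha> \<beta> < 1"
  proof -
    obtain q where q: "q \<in> Q" "real_of_rat q < 1" using Q_less[OF \<open>Dist \<alpha> \<beta> < 1\<close>] by blast
    then have q1: "q < 1" by (simp add: of_rat_less_1_iff)
    have "left_ce (real_of_rat q * \<alpha> - \<beta>)" using q(1) by (simp add: Q_def)
    moreover have "left_ce (real_of_rat (1 - q) * \<alpha>)" using q1 assms(1) by (simp add: left_ce_scale)
    moreover have "solovay_random (real_of_rat (1 - q) * \<alpha>)"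
      using q1 random by (simp add: solovay_random_scale)
    moreover have "\<alpha> - \<beta> = (real_of_rat q * \<alpha> - \<beta>) + real_of_rat (1 - q) * \<alpha>"
      by (simp add: of_rat_diff algebra_simps)
    ultimately show ?thesis using left_ce_add solovay_random_add by metis
  qed

  have c: "solovay_random (\<alpha> - \<beta>) \<and> right_ce (\<alpha> - \<beta>)" if "Dist \<alpha> \<beta> > 1"
  proof -
    obtain d where d: "1 < real_of_rat d" "real_of_rat d < Dist \<alpha> \<beta>"
      using of_rat_dense[OF \<open>Dist \<alpha> \<beta> > 1\<close>] by blast
    then have "1 < d" by (simp add: of_rat_less_1_iff)
    \<comment> \<open>Two numbers above 1 are needed: \<open>d\<close>, below the infimum, excludes
      the first alternative of the dichotomy, and \<open>c > 1\<close> leaves the positive multiple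
      \<open>c - 1\<close> of \<alpha> that carries the randomness.\<close>
    then obtain c where c: "1 < c" "c < d" using dense by blast
    have "d \<notin> Q" using Q_ge[of d] d by auto
    then have "\<not> left_ce (real_of_rat d * \<alpha> - \<beta>)" using \<open>1 < d\<close> by (simp add: Q_def)
    then have "left_ce (\<beta> - real_of_rat c * \<alpha>)"
      using left_ce_dichotomy[OF assms(1) random assms(3), of c d] c by auto
    moreover have "left_ce (real_of_rat (c - 1) * \<alpha>)" using c assms(1) by (simp add: left_ce_scale)
    moreover have "solovay_random (real_of_rat (c - 1) * \<alpha>)"
      using c random by (simp add: solovay_random_scale)
    moreover have "- (\<alpha> - \<beta>) = (\<beta> - real_of_rat c * \<alpha>) + real_of_rat (c - 1) * \<alpha>"
      by (simp add: of_rat_diff algebra_simps)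
    ultimately have "left_ce (- (\<alpha> - \<beta>))" "solovay_random (- (\<alpha> - \<beta>))"
      using left_ce_add solovay_random_add by metis+
    then show ?thesis using solovay_random_minus[of "- (\<alpha> - \<beta>)"] by (simp add: right_ce_iff)
  qed

  have b: "\<not> solovay_random (\<alpha> - \<beta>)" if D1: "Dist \<alpha> \<beta> = 1"
  proof
    assume x: "solovay_random (\<alpha> - \<beta>)"
    \<comment> \<open>Adding one more copy of \<open>y\<close> brings the factor above 1, so that
      \<open>1 - 1 / q\<close> and \<open>q - 1\<close> below are positive.\<close>
    have large: "\<exists>q>1. left_ce (real_of_rat q * y - z)"
      if y: "left_ce y" "solovay_random y" and z: "left_ce z" for y z
    proof -
      obtain q where q: "q > 0" "left_ce (real_of_rat q * y - z)"
        using kucera_slaman[OF y z] by blast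
      have "left_ce ((real_of_rat q * y - z) + real_of_rat 1 * y)"
        by (intro left_ce_add left_ce_scale q y) simp
      moreover have "(real_of_rat q * y - z) + real_of_rat 1 * y = real_of_rat (q + 1) * y - z"
        by (simp add: of_rat_add algebra_simps)
      ultimately have "left_ce (real_of_rat (q + 1) * y - z)" by (simp only:)
      then show ?thesis using q(1) by (intro exI[of _ "q + 1"]) simp
    qed
    from solovay_random_diff_one_sided[OF assms(1,3) x] show False
    proof
      assume "left_ce (\<alpha> - \<beta>)"
      \<comment> \<open>Here the difference dominates \<alpha> itself. Division by \<open>q\<close>
        turns \<open>q * (\<alpha> - \<beta>) - \<alpha>\<close> into
        \<open>(1 - 1 / q) * \<alpha> - \<beta>\<close>, an admissible slope below 1.\<close>
      from large[OF this x assms(1)] obtain q where q: "q > 1"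
        "left_ce (real_of_rat q * (\<alpha> - \<beta>) - \<alpha>)" by blast
      have "left_ce (real_of_rat (1 / q) * (real_of_rat q * (\<alpha> - \<beta>) - \<alpha>))"
        using q by (intro left_ce_scale) auto
      moreover have "real_of_rat (1 / q) * (real_of_rat q * (\<alpha> - \<beta>) - \<alpha>)
          = real_of_rat (1 - 1 / q) * \<alpha> - \<beta>"
        using q(1) by (simp add: of_rat_diff of_rat_divide field_simps)
      ultimately have "1 - 1 / q \<in> Q" using q(1) by (simp add: Q_def)
      from Q_ge[OF this] q(1) D1 show False by (simp add: of_rat_diff of_rat_divide)
    next
      assume "left_ce (\<beta> - \<alpha>)"
      moreover have "solovay_random (\<beta> - \<alpha>)" using solovay_random_minus[OF x] by simp
      ultimately obtain q where q: "q > 1" "left_ce (real_of_rat q * (\<beta> - \<alpha>) - \<beta>)"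
        using large assms(3) by blast
      \<comment> \<open>Collecting terms gives \<open>(q - 1) * \<beta> - q * \<alpha>\<close>, so
        the factor \<open>1 / (q - 1)\<close> normalises the coefficient of \<beta>.\<close>
      have "left_ce (real_of_rat (1 / (q - 1)) * (real_of_rat q * (\<beta> - \<alpha>) - \<beta>))"
        using q by (intro left_ce_scale) auto
      moreover have "real_of_rat (1 / (q - 1)) * (real_of_rat q * (\<beta> - \<alpha>) - \<beta>)
          = \<beta> - real_of_rat (q / (q - 1)) * \<alpha>"
      proof -
        define t where "t = real_of_rat q"
        have "t > 1" using q(1) by (simp add: t_def)
        then have "1 / (t - 1) * (t * (\<beta> - \<alpha>) - \<beta>) = \<beta> - t / (t - 1) * \<alpha>"
          by (simp add: field_simps)
        then show ?thesis by (simp add: of_rat_diff of_rat_divide t_def)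
      qed
      ultimately have p: "left_ce (\<beta> - real_of_rat (q / (q - 1)) * \<alpha>)" by simp
      have "1 < q / (q - 1)" using q(1) by simp
      then have "Dist \<alpha> \<beta> < real_of_rat (q / (q - 1))" unfolding D1 by (simp only: one_less_of_rat_iff)
      then obtain r where r: "r \<in> Q" "real_of_rat r < real_of_rat (q / (q - 1))"
        using Q_less by blast
      define e where "e = q / (q - 1) - r"
      have "e > 0" using r(2) by (simp add: e_def of_rat_less)
      \<comment> \<open>Since the infimum is 1, some admissible slope \<open>r\<close> lies below
        \<open>q / (q - 1)\<close>. The sum cancels \<beta> and makes a negative multiple of
        \<alpha> left-c.e.; adding the opposite random multiple would make 0 random.\<close>
      have "left_ce ((\<beta> - real_of_rat (q / (q - 1)) * \<alpha>) + (real_of_rat r * \<alpha> - \<beta>))"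
        using p r(1) by (intro left_ce_add) (simp_all add: Q_def)
      moreover have "(\<beta> - real_of_rat (q / (q - 1)) * \<alpha>) + (real_of_rat r * \<alpha> - \<beta>)
          = - (real_of_rat e * \<alpha>)"
        unfolding e_def by (simp add: of_rat_diff algebra_simps)
      ultimately have "left_ce (- (real_of_rat e * \<alpha>))" by simp
      moreover have "left_ce (real_of_rat e * \<alpha>)" "solovay_random (real_of_rat e * \<alpha>)"
        using \<open>e > 0\<close> by (auto intro: left_ce_scale solovay_random_scale assms(1) random)
      ultimately have "solovay_random (- (real_of_rat e * \<alpha>) + real_of_rat e * \<alpha>)"
        by (rule solovay_random_add)
      then show False using not_solovay_random_0 by simp
    qed
  qed

  show ?thesis using a b c by (simp add: mloef_random_real_iff)
qed

end
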